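(* Let $\mu$ be a shift-invariant ergodic Borel probability measure on $\{1,2\}^{\mathbb{N}}$. If $\mu([12121212])>0$, then for $\mu$-almost every directive sequence $(i_n)_{n\in\mathbb{N}}\in\{1,2\}^{\mathbb{N}}$, the word $\mathbf{w}=\lim_{n\to\infty}c_{i_0}\cdots c_{i_n}(1^\omega)$ is balanced, and the second Lyapunov exponent $\theta_2^\mu$ of the cocycle with matrices $\{C_1,C_2\}$ is negative.
   Context: $c_1,c_2$ are the endomorphisms of the free monoid $\{1,2,3\}^*$ given by $c_1:1\mapsto1,\ 2\mapsto13,\ 3\mapsto2$ and $c_2:1\mapsto2,\ 2\mapsto13,\ 3\mapsto3$; they act on infinite words letterwise, and $1^\omega=111\cdots$. Their incidence matrices are $C_1=\begin{pmatrix}1&1&0\\0&0&1\\0&1&0\end{pmatrix}$ and $C_2=\begin{pmatrix}0&1&0\\1&0&0\\0&1&1\end{pmatrix}$. The cylinder $[u]$ of a finite word $u$ is the set of sequences of $\{1,2\}^{\mathbb{N}}$ having $u$ as a prefix; the shift is $S((i_n)_n)=(i_{n+1})_n$. An infinite word $\mathbf{w}$ over an alphabet $A$ is balanced if there is a constant $K>0$ such that for all factors $u,v$ of $\mathbf{w}$ of the same length and every letter $a\in A$, $\bigl||u|_a-|v|_a\bigr|\le K$, where $|u|_a$ is the number of occurrences of $a$ in $u$. For $\gamma\in\{1,2\}^{\mathbb{N}}$ and $n\ge0$ put $A_n(\gamma)=C_{\gamma_0}C_{\gamma_1}\cdots C_{\gamma_{n-1}}$. The Lyapunov exponents $\theta_1^\mu\ge\theta_2^\mu\ge\theta_3^\mu$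 of this cocycle are defined by the $\mu$-almost everywhere limits $\theta_1^\mu=\lim_n\frac1n\log\|A_n(\gamma)\|$, $\theta_1^\mu+\theta_2^\mu=\lim_n\frac1n\log\|\wedge^2A_n(\gamma)\|$, $\theta_1^\mu+\theta_2^\mu+\theta_3^\mu=\lim_n\frac1n\log\|\wedge^3A_n(\gamma)\|$, where $\wedge^k$ is the $k$-th exterior power (independent of the chosen norms). *)

theory Defs
  imports "HOL-Probability.Probability"
begin

section \<open>The substitutions and infinite words\<close>

text \<open>
  Letters are the elements 1, 2, 3 of the type \<open>3\<close> and directive sequences are streams over
  the elements 1, 2 of the type \<open>2\<close>; in these types 3 and 2, respectively, also denote 0.
\<close>

definition c1 :: "3 \<Rightarrow> 3 list" where
  "c1 a = (if a = 1 then [1] else if a = 2 then [1, 3] else [2])"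

definition c2 :: "3 \<Rightarrow> 3 list" where
  "c2 a = (if a = 1 then [2] else if a = 2 then [1, 3] else [3])"

definition csubst :: "2 \<Rightarrow> 3 \<Rightarrow> 3 list" where
  "csubst i = (if i = 1 then c1 else c2)"

definition apply_subst :: "('a \<Rightarrow> 'b list) \<Rightarrow> 'a stream \<Rightarrow> 'b stream" where
  "apply_subst \<sigma> w = flat (smap \<sigma> w)"

lemma csubst_nonempty: "csubst i a \<noteq> []"
  by (simp add: csubst_def c1_def c2_def)

text \<open>\<open>c\<^sub>i\<^sub>0 \<dots> c\<^sub>i\<^sub>n (1\<^sup>\<omega>)\<close>, where the substitution with index \<open>i\<^sub>n\<close> acts first.\<close>

definition approx_word :: "2 stream \<Rightarrow> nat \<Rightarrow> 3 stream" where
  "approx_word \<gamma> n = foldr (\<lambda>i. apply_subst (csubst i)) (stake (Suc n) \<gamma>) (sconst 1)"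

text \<open>Convergence in the product of the discrete topologies.\<close>

definition word_tendsto :: "(nat \<Rightarrow> 'a stream) \<Rightarrow> 'a stream \<Rightarrow> bool" where
  "word_tendsto W w \<longleftrightarrow> (\<forall>k. \<forall>\<^sub>F n in sequentially. stake k (W n) = stake k w)"

definition factor :: "'a list \<Rightarrow> 'a stream \<Rightarrow> bool" where
  "factor u w \<longleftrightarrow> (\<exists>m n. u = stake n (sdrop m w))"

definition balanced :: "'a stream \<Rightarrow> bool" where
  "balanced w \<longleftrightarrow> (\<exists>K::real. K > 0 \<and> (\<forall>u v a. factor u w \<and> factor v w \<and> length u = length v
      \<longrightarrow> \<bar>real (count_list u a) - real (count_list v a)\<bar> \<le> K))"


section \<open>Shift-invariant ergodic measures\<close>

definition cylinder :: "'a list \<Rightarrow> 'a stream set" where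
  "cylinder u = {s. stake (length u) s = u}"

text \<open>
  The alphabet being finite and discrete, the sigma-algebra of
  \<open>stream_space (count_space UNIV)\<close> is the Borel sigma-algebra of the product topology.
  The shift is \<^const>\<open>stl\<close>.
\<close>

definition ergodic_shift_measure :: "'a::finite stream measure \<Rightarrow> bool" where
  "ergodic_shift_measure \<mu> \<longleftrightarrow>
     prob_space \<mu> \<and> sets \<mu> = sets (stream_space (count_space UNIV)) \<and>
     distr \<mu> \<mu> stl = \<mu> \<and>
     (\<forall>A\<in>sets \<mu>. stl -` A = A \<longrightarrow> measure \<mu> A = 0 \<or> measure \<mu> A = 1)"


section \<open>The cocycle and its Lyapunov exponents\<close>

definition C1 :: "real^3^3" where
  "C1 = vector [vector [1, 1, 0], vector [0, 0, 1], vector [0, 1, 0]]"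

definition C2 :: "real^3^3" where
  "C2 = vector [vector [0, 1, 0], vector [1, 0, 0], vector [0, 1, 1]]"

definition cmatrix :: "2 \<Rightarrow> real^3^3" where
  "cmatrix i = (if i = 1 then C1 else C2)"

lemma cmatrix_incidence: "cmatrix i $ a $ b = real (count_list (csubst i b) a)"
proof -
  have "\<forall>a b. cmatrix i $ a $ b = real (count_list (csubst i b) a)"
    by (auto simp: forall_3 cmatrix_def csubst_def C1_def C2_def c1_def c2_def)
  thus ?thesis by blast
qed

definition cocycle :: "nat \<Rightarrow> 2 stream \<Rightarrow> real^3^3" where
  "cocycle n \<gamma> = foldr (\<lambda>i M. cmatrix i ** M) (stake n \<gamma>) (mat 1)"

text \<open>
  Increasing lists \<open>I = [i\<^sub>1, \<dots>, i\<^sub>k]\<close> of indices index the standard basis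
  \<open>e\<^sub>I = e\<^sub>i\<^sub>1 \<and> \<dots> \<and> e\<^sub>i\<^sub>k\<close> of the \<open>k\<close>-th exterior power. In this basis the \<open>k\<close>-th exterior
  power of \<open>A\<close> maps \<open>e\<^sub>J = e\<^sub>j\<^sub>1 \<and> \<dots> \<and> e\<^sub>j\<^sub>k\<close> to \<open>A e\<^sub>j\<^sub>1 \<and> \<dots> \<and> A e\<^sub>j\<^sub>k\<close>, whose \<open>e\<^sub>I\<close>-coordinate is the
  minor of \<open>A\<close> with rows \<open>I\<close> and columns \<open>J\<close>. On the type \<open>3\<close> the order is \<open>3 < 1 < 2\<close>; the choice
  of the order changes the basis vectors only by signs.
\<close>

definition ext_basis :: "nat \<Rightarrow> 'n::linorder list set" where
  "ext_basis k = {I. length I = k \<and> sorted_wrt (<) I}"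

definition ext_entry :: "real^'n::{finite,linorder}^'n::{finite,linorder} \<Rightarrow> 'n list \<Rightarrow> 'n list \<Rightarrow> real" where
  "ext_entry A I J =
     (\<Sum>p | p permutes {..<length I}.
        of_int (sign p) * (\<Prod>l<length I. A $ (I ! l) $ (J ! p l)))"

text \<open>The maximum norm of the matrix of the \<open>k\<close>-th exterior power, for \<open>1 \<le> k \<le> CARD('n)\<close>.\<close>

definition ext_norm :: "nat \<Rightarrow> real^'n::{finite,linorder}^'n::{finite,linorder} \<Rightarrow> real" where
  "ext_norm k A = Max {\<bar>ext_entry A I J\<bar> | I J. I \<in> ext_basis k \<and> J \<in> ext_basis k}"

lemma ext_entry_singleton: "ext_entry A [i] [j] = A $ i $ j"
  by (simp add: ext_entry_def lessThan_Suc)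

lemma finite_ext_basis: "finite (ext_basis k :: 'n::{finite,linorder} list set)"
  by (rule finite_subset[OF _ finite_lists_length_eq[OF finite, of UNIV k]])
     (auto simp: ext_basis_def)

definition lyapunov_exponents :: "2 stream measure \<Rightarrow> real \<Rightarrow> real \<Rightarrow> real \<Rightarrow> bool" where
  "lyapunov_exponents \<mu> \<theta>1 \<theta>2 \<theta>3 \<longleftrightarrow>
     \<theta>1 \<ge> \<theta>2 \<and> \<theta>2 \<ge> \<theta>3 \<and>
     (AE \<gamma> in \<mu>. (\<lambda>n. ln (ext_norm 1 (cocycle n \<gamma>)) / real n) \<longlonglongrightarrow> \<theta>1) \<and>
     (AE \<gamma> in \<mu>. (\<lambda>n. ln (ext_norm 2 (cocycle n \<gamma>)) / real n) \<longlonglongrightarrow> \<theta>1 + \<theta>2) \<and>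
     (AE \<gamma> in \<mu>. (\<lambda>n. ln (ext_norm 3 (cocycle n \<gamma>)) / real n) \<longlonglongrightarrow> \<theta>1 + \<theta>2 + \<theta>3)"

end

theory Submission
  imports Defs
begin

text \<open>
  A linear form \<open>v\<close> evolves along a directive sequence by the transposed matrices. If it vanishes at the
  frequency vector \<open>f\<close>, it never becomes positive or negative on the whole positive cone, and then the
  difference between its largest and smallest coefficient, maximized over two consecutive times, does
  not increase; reading \<open>12121\<close> multiplies it by at most 4/5. By the ergodic theorem the block
  \<open>12121212\<close> occurs with positive frequency almost surely, so the forms vanishing at \<open>f\<close> decay
  exponentially.

  The deviation of the number of letters \<open>a\<close> in a prefix from its expected value is the value of such a
  form, and the Dumont-Thomas decomposition of prefixes bounds it by a geometric series, which gives
  balancedness. The decay also says that \<open>A\<^sub>n\<close> is exponentially close to a matrix of rank one, so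
  \<open>\<and>\<^sup>2 A\<^sub>n\<close> is exponentially small compared with \<open>A\<^sub>n\<close>, which gives \<open>\<theta>\<^sub>2 < 0\<close>. The exponents
  exist by the subadditive ergodic theorem, and \<open>\<theta>\<^sub>2 \<ge> \<theta>\<^sub>3\<close> holds because \<open>A\<^sub>n\<close> is, up to sign, the
  cofactor matrix of its cofactor matrix.
\<close>

section \<open>Contraction of linear forms\<close>

text \<open>The negation of strict definiteness: the form is neither positive nor negative at all
  nonzero points of the positive cone.\<close>

definition mixed_sign :: "real^3 \<Rightarrow> bool" where
  "mixed_sign v \<longleftrightarrow> (\<exists>i. v $ i \<ge> 0) \<and> (\<exists>i. v $ i \<le> 0)"

text \<open>Largest minus smallest coefficient; pairwise differences turn bounds on it into linear
  inequalities.\<close>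

definition spread :: "real^3 \<Rightarrow> real" where
  "spread v = max \<bar>v $ 1 - v $ 2\<bar> (max \<bar>v $ 2 - v $ 3\<bar> \<bar>v $ 1 - v $ 3\<bar>)"

lemma exists_3: "(\<exists>i::3. P i) \<longleftrightarrow> P 1 \<or> P 2 \<or> P 3"
  by (metis exhaust_3)

lemma spread_nonneg: "spread v \<ge> 0"
  by (simp add: spread_def le_max_iff_disj)

lemma abs_le_spread:
  assumes "mixed_sign v"
  shows "\<bar>v $ i\<bar> \<le> spread v"
proof -
  have "\<forall>i. \<bar>v $ i\<bar> \<le> spread v"
    using assms unfolding mixed_sign_def spread_def forall_3 exists_3 le_max_iff_disj
    by (elim conjE disjE) (auto simp: abs_if split: if_splits)
  then show ?thesis by blast
qed

lemma vector_cmatrix_1: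
  "(v v* cmatrix 1) $ 1 = v $ 1"
  "(v v* cmatrix 1) $ 2 = v $ 1 + v $ 3"
  "(v v* cmatrix 1) $ 3 = v $ 2"
  by (simp_all add: vector_matrix_mult_def cmatrix_def C1_def sum_3)

lemma vector_cmatrix_2:
  "(v v* cmatrix 2) $ 1 = v $ 2"
  "(v v* cmatrix 2) $ 2 = v $ 1 + v $ 3"
  "(v v* cmatrix 2) $ 3 = v $ 3"
  by (simp_all add: vector_matrix_mult_def cmatrix_def C2_def sum_3)

lemma index_cases: "(i::2) = 1 \<or> i = 2"
  using exhaust_2 by blast

text \<open>With \<open>u = v v* cmatrix i\<close>, each difference of coefficients of
  \<open>u v* cmatrix j\<close> is, up to sign, a coefficient of \<open>u\<close>, a difference of
  \<open>u\<close>, or \<open>u $ 1 + u $ 3 - u $ 2\<close>, which is a difference of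
  \<open>v\<close>. This is why two consecutive times are taken together.\<close>

lemma spread_two_steps:
  assumes "mixed_sign (v v* cmatrix i)"
  shows "spread ((v v* cmatrix i) v* cmatrix j) \<le> max (spread v) (spread (v v* cmatrix i))"
proof -
  define u where "u = v v* cmatrix i"
  define d where "d = max (spread v) (spread u)"
  have diffs: "\<bar>u $ 1 - u $ 2\<bar> \<le> spread u" "\<bar>u $ 2 - u $ 3\<bar> \<le> spread u"
    by (auto simp: spread_def)
  have "\<bar>u $ 1 + u $ 3 - u $ 2\<bar> \<le> spread v"
    using index_cases[of i]
    by (auto simp: u_def vector_cmatrix_1 vector_cmatrix_2 spread_def le_max_iff_disj)
  then have bounds: "\<bar>u $ 1\<bar> \<le> d" "\<bar>u $ 3\<bar> \<le> d" "\<bar>u $ 1 - u $ 2\<bar> \<le> d" "\<bar>u $ 2 - u $ 3\<bar> \<le> d"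
      "\<bar>u $ 1 + u $ 3 - u $ 2\<bar> \<le> d"
    using diffs abs_le_spread[OF assms, of 1] abs_le_spread[OF assms, of 3]
    by (simp_all add: d_def le_max_iff_disj flip: u_def)
  show ?thesis
    using index_cases[of j]
  proof
    assume j: "j = 1"
    show ?thesis
      unfolding u_def[symmetric] d_def[symmetric] spread_def[of "u v* _"] j vector_cmatrix_1 max.bounded_iff
      using bounds unfolding abs_le_iff by linarith
  next
    assume j: "j = 2"
    show ?thesis
      unfolding u_def[symmetric] d_def[symmetric] spread_def[of "u v* _"] j vector_cmatrix_2 max.bounded_iff
      using bounds unfolding abs_le_iff by linarith
  qed
qed

text \<open>
  After \<open>12121\<close> the form with coefficients \<open>a, b, c\<close> has coefficients \<open>a+b+c, 2a+2b+c, 2a+b+c\<close>, and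
  \<open>4/5\<close> is the maximum over the polytope given by the hypotheses with \<open>d = 1\<close>.
\<close>

lemma five_step_bounds_aux:
  fixes a b c d :: real
  assumes "a - b \<le> d" "b - a \<le> d" "b - c \<le> d" "c - b \<le> d" "a - c \<le> d" "c - a \<le> d"
      "c \<le> d" "- c \<le> d" "a + c - b \<le> d" "b - a - c \<le> d"
    and "0 \<le> a + b + c \<and> 2 * a + 2 * b + c \<le> 0 \<or> 0 \<le> a + b + c \<and> 2 * a + b + c \<le> 0 \<or>
      0 \<le> 2 * a + b + c \<and> 2 * a + 2 * b + c \<le> 0"
  shows "a \<le> 4/5 * d" "- a \<le> 4/5 * d" "b \<le> 4/5 * d" "- b \<le> 4/5 * d" "c \<le> 4/5 * d" "- c \<le> 4/5 * d"
    "a + b \<le> 4/5 * d" "- (a + b) \<le> 4/5 * d" "a + c \<le> 4/5 * d" "- (a + c) \<le> 4/5 * d"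
  using assms by linarith+

lemma five_step_bounds:
  fixes a b c d :: real
  assumes d: "\<bar>a - b\<bar> \<le> d" "\<bar>b - c\<bar> \<le> d" "\<bar>a - c\<bar> \<le> d" "\<bar>c\<bar> \<le> d" "\<bar>a + c - b\<bar> \<le> d"
    and pos: "0 \<le> a + b + c \<or> 0 \<le> 2 * a + 2 * b + c \<or> 0 \<le> 2 * a + b + c"
    and neg: "a + b + c \<le> 0 \<or> 2 * a + 2 * b + c \<le> 0 \<or> 2 * a + b + c \<le> 0"
  shows "\<bar>a\<bar> \<le> 4/5 * d" "\<bar>b\<bar> \<le> 4/5 * d" "\<bar>c\<bar> \<le> 4/5 * d"
    "\<bar>a + b\<bar> \<le> 4/5 * d" "\<bar>a + c\<bar> \<le> 4/5 * d"
proof -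
  have "\<bar>a\<bar> \<le> 4/5 * d \<and> \<bar>b\<bar> \<le> 4/5 * d \<and> \<bar>c\<bar> \<le> 4/5 * d \<and> \<bar>a + b\<bar> \<le> 4/5 * d \<and> \<bar>a + c\<bar> \<le> 4/5 * d"
  proof (cases "0 \<le> a + b + c \<and> 2 * a + 2 * b + c \<le> 0 \<or> 0 \<le> a + b + c \<and> 2 * a + b + c \<le> 0 \<or>
      0 \<le> 2 * a + b + c \<and> 2 * a + 2 * b + c \<le> 0")
    case True
    have "a - b \<le> d" "b - a \<le> d" "b - c \<le> d" "c - b \<le> d" "a - c \<le> d" "c - a \<le> d"
      "c \<le> d" "- c \<le> d" "a + c - b \<le> d" "b - a - c \<le> d"
      using d by (simp_all add: abs_le_iff)
    from five_step_bounds_aux[OF this True] show ?thesis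
      unfolding abs_le_iff by blast
  next
    case False
    \<comment> \<open>The remaining sign patterns arise from the three treated ones by negating
      \<open>a\<close>, \<open>b\<close>, \<open>c\<close>, which preserves the bounds.\<close>
    then have neg: "0 \<le> - a + - b + - c \<and> 2 * - a + 2 * - b + - c \<le> 0 \<or> 0 \<le> - a + - b + - c \<and> 2 * - a + - b + - c \<le> 0 \<or>
      0 \<le> 2 * - a + - b + - c \<and> 2 * - a + 2 * - b + - c \<le> 0"
      using pos neg by argo
    have "- a - (- b) \<le> d" "- b - (- a) \<le> d" "- b - (- c) \<le> d" "- c - (- b) \<le> d" "- a - (- c) \<le> d"
      "- c - (- a) \<le> d" "- c \<le> d" "- (- c) \<le> d" "- a + - c - (- b) \<le> d" "- b - (- a) - (- c) \<le> d"
      using d by (simp_all add: abs_le_iff)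
    from five_step_bounds_aux[OF this neg] show ?thesis
      unfolding abs_le_iff by auto
  qed
  then show "\<bar>a\<bar> \<le> 4/5 * d" "\<bar>b\<bar> \<le> 4/5 * d" "\<bar>c\<bar> \<le> 4/5 * d"
      "\<bar>a + b\<bar> \<le> 4/5 * d" "\<bar>a + c\<bar> \<le> 4/5 * d"
    by auto
qed

text \<open>Up to sign, the differences are \<open>a\<close>, \<open>a + c\<close>, \<open>c\<close>
  after \<open>1212\<close> and \<open>a\<close>, \<open>b\<close>, \<open>a + b\<close> after
  \<open>12121\<close>, exactly the quantities bounded in \<open>five_step_bounds\<close>.\<close>

lemma spread_five_steps:
  assumes "mixed_sign (((((v v* cmatrix 1) v* cmatrix 2) v* cmatrix 1) v* cmatrix 2) v* cmatrix 1)"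
  shows "max (spread ((((v v* cmatrix 1) v* cmatrix 2) v* cmatrix 1) v* cmatrix 2))
        (spread (((((v v* cmatrix 1) v* cmatrix 2) v* cmatrix 1) v* cmatrix 2) v* cmatrix 1))
      \<le> 4/5 * max (spread v) (spread (v v* cmatrix 1))"
proof -
  define a b c where "a = v $ 1" and "b = v $ 2" and "c = v $ 3"
  define d where "d = max (spread v) (spread (v v* cmatrix 1))"
  have d: "\<bar>a - b\<bar> \<le> d" "\<bar>b - c\<bar> \<le> d" "\<bar>a - c\<bar> \<le> d" "\<bar>c\<bar> \<le> d" "\<bar>a + c - b\<bar> \<le> d"
    by (simp_all add: d_def spread_def vector_cmatrix_1 a_def b_def c_def le_max_iff_disj)
  have mixed: "0 \<le> a + b + c \<or> 0 \<le> 2 * a + 2 * b + c \<or> 0 \<le> 2 * a + b + c"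
    "a + b + c \<le> 0 \<or> 2 * a + 2 * b + c \<le> 0 \<or> 2 * a + b + c \<le> 0"
    using assms
    by (simp_all add: mixed_sign_def exists_3 vector_cmatrix_1 vector_cmatrix_2 algebra_simps
        flip: a_def b_def c_def)
  note bounds = five_step_bounds[OF d mixed]
  show ?thesis
    unfolding d_def[symmetric]
    unfolding spread_def vector_cmatrix_1 vector_cmatrix_2 max.bounded_iff
      a_def[symmetric] b_def[symmetric] c_def[symmetric]
    using bounds unfolding abs_le_iff by linarith
qed

section \<open>The cocycle\<close>

lemma cocycle_0: "cocycle 0 \<gamma> = mat 1"
  by (simp add: cocycle_def)

lemma cocycle_Suc_shift: "cocycle (Suc n) \<gamma> = cmatrix (shd \<gamma>) ** cocycle n (stl \<gamma>)"
  by (simp add: cocycle_def)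

lemma cocycle_add: "cocycle (m + n) \<gamma> = cocycle m \<gamma> ** cocycle n (sdrop m \<gamma>)"
  by (induction m arbitrary: \<gamma>) (simp_all add: cocycle_0 cocycle_Suc_shift matrix_mul_assoc)

lemma cocycle_1: "cocycle 1 \<gamma> = cmatrix (shd \<gamma>)"
  by (simp add: cocycle_def)

lemma cocycle_Suc: "cocycle (Suc n) \<gamma> = cocycle n \<gamma> ** cmatrix (\<gamma> !! n)"
  using cocycle_add[of n 1 \<gamma>] unfolding cocycle_1 by simp

lemma vector_cocycle_Suc: "v v* cocycle (Suc n) \<gamma> = (v v* cocycle n \<gamma>) v* cmatrix (\<gamma> !! n)"
  by (simp add: cocycle_Suc vector_matrix_mul_assoc)

lemma cmatrix_nonneg: "cmatrix i $ a $ b \<ge> 0"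
  by (simp add: cmatrix_incidence)

lemma cocycle_nonneg: "cocycle n \<gamma> $ a $ b \<ge> 0"
proof (induction n arbitrary: \<gamma> a b)
  case 0
  then show ?case by (simp add: cocycle_0 mat_def)
next
  case (Suc n)
  then show ?case
    by (auto simp: cocycle_Suc_shift matrix_matrix_mult_def cmatrix_nonneg intro!: sum_nonneg mult_nonneg_nonneg)
qed

text \<open>The column sums are the lengths of the images of the letters under the composed
  substitutions, which are nonempty.\<close>

lemma column_sum_ge_1: "(vec 1 v* cocycle n \<gamma>) $ b \<ge> 1"
proof (induction n arbitrary: b)
  case 0
  then show ?case by (simp add: cocycle_0)
next
  case (Suc n)
  define w where "w = vec 1 v* cocycle n \<gamma>"
  have w: "w $ b \<ge> 1" for b
    unfolding w_def by (rule Suc)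
  have w13: "1 \<le> w $ 1 + w $ 3"
    using w[of 1] w[of 3] by linarith
  have "(w v* cmatrix (\<gamma> !! n)) $ 1 \<ge> 1 \<and> (w v* cmatrix (\<gamma> !! n)) $ 2 \<ge> 1 \<and> (w v* cmatrix (\<gamma> !! n)) $ 3 \<ge> 1"
    using index_cases[of "\<gamma> !! n"] w w13 by (auto simp: vector_cmatrix_1 vector_cmatrix_2)
  then have "\<forall>b. (w v* cmatrix (\<gamma> !! n)) $ b \<ge> 1"
    by (simp add: forall_3)
  then show ?case
    by (simp add: vector_cocycle_Suc w_def)
qed

text \<open>
  A limit point \<open>f\<close> of the normalized vectors \<open>A\<^sub>n (1,1,1)\<close> lies in all cones \<open>A\<^sub>n \<real>\<^sub>\<ge>\<^sub>0\<^sup>3\<close>, so that a linear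
  form vanishing at \<open>f\<close> cannot become positive on the whole positive cone after applying \<open>A\<^sub>n\<close>.
\<close>

lemma frequency_vector:
  obtains f :: "real^3" where "\<And>a. 0 \<le> f $ a" "\<And>a. f $ a \<le> 1" "(\<Sum>a\<in>UNIV. f $ a) = 1"
    "\<And>v n. v \<bullet> f = 0 \<Longrightarrow> mixed_sign (v v* cocycle n \<gamma>)"
proof -
  define e :: "real^3" where "e = vec 1"
  define y where "y n = cocycle n \<gamma> *v e" for n
  define s where "s n = e \<bullet> y n" for n
  define x where "x n = (1 / s n) *\<^sub>R y n" for n
  have e_dot: "e \<bullet> u = (\<Sum>a\<in>UNIV. u $ a)" for u
    by (simp add: e_def inner_vec_def)
  have y_nonneg: "y n $ a \<ge> 0" for n a
    by (auto simp: y_def matrix_vector_mult_def e_def intro!: sum_nonneg cocycle_nonneg)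
  have s_pos: "s n > 0" for n
  proof -
    have "s n = (\<Sum>a\<in>UNIV. (e v* cocycle n \<gamma>) $ a)"
      by (simp add: s_def y_def flip: dot_lmul_matrix) (simp add: e_def inner_vec_def)
    also have "\<dots> > 0"
      by (rule sum_pos) (use column_sum_ge_1[of n \<gamma>] in \<open>auto simp: e_def intro: less_le_trans[of 0 1]\<close>)
    finally show ?thesis .
  qed
  have x_nonneg: "x n $ a \<ge> 0" for n a
    using y_nonneg[of n a] s_pos[of n] by (simp add: x_def)
  have x_sum: "(\<Sum>a\<in>UNIV. x n $ a) = 1" for n
  proof -
    have "e \<bullet> x n = 1"
      using s_pos[of n] by (simp add: x_def s_def)
    then show ?thesis by (simp add: e_dot)
  qed
  have x_le: "x n $ a \<le> 1" for n a
    using member_le_sum[of a UNIV "\<lambda>a. x n $ a"] x_nonneg x_sum by simp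
  have "\<forall>n. x n \<in> cbox (vec 0) (vec 1)"
    by (simp add: mem_box_cart x_nonneg x_le)
  then obtain f r where f: "f \<in> cbox (vec 0) (vec 1)" and r: "strict_mono r"
    and lim: "(x \<circ> r) \<longlonglongrightarrow> f"
    using compact_cbox[of "vec 0" "vec 1 :: real^3"] unfolding compact_def by metis
  have f_bounds: "0 \<le> f $ a" "f $ a \<le> 1" for a
    using f by (simp_all add: mem_box_cart)
  have "(\<lambda>n. e \<bullet> (x \<circ> r) n) \<longlonglongrightarrow> e \<bullet> f"
    by (intro tendsto_intros lim)
  then have f_sum: "(\<Sum>a\<in>UNIV. f $ a) = 1"
    by (simp add: e_dot x_sum LIMSEQ_const_iff)
  have not_pos: "\<exists>a. (v v* cocycle m \<gamma>) $ a \<le> 0" if v: "v \<bullet> f = 0" for v m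
  proof (rule ccontr)
    assume neg: "\<not> (\<exists>a. (v v* cocycle m \<gamma>) $ a \<le> 0)"
    define u w where "u = v v* cocycle m \<gamma>" and "w = e v* cocycle m \<gamma>"
    have u: "u $ a > 0" for a
      using neg by (simp add: u_def not_le)
    have w: "w $ a \<ge> 1" for a
      unfolding w_def e_def by (rule column_sum_ge_1)
    \<comment> \<open>The best constant with \<open>d * w $ a \<le> u $ a\<close>. As
      \<open>y n\<close> is the image of a nonnegative vector \<open>z\<close> under
      \<open>cocycle m \<gamma>\<close>, it gives \<open>d * s n \<le> v \<bullet> y n\<close> for
      all \<open>n \<ge> m\<close>, a bound that survives the limit.\<close>
    define d where "d = Min (range (\<lambda>a. u $ a / w $ a))"
    have "0 < u $ a / w $ a" for a
      using u[of a] w[of a] by simp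
    then have d: "d > 0"
      by (simp add: d_def)
    have uw: "d * w $ a \<le> u $ a" for a
    proof -
      have "d \<le> u $ a / w $ a"
        unfolding d_def by (rule Min_le) auto
      then show ?thesis
        using w[of a] by (simp add: field_simps)
    qed
    have "d \<le> v \<bullet> x n" if "n \<ge> m" for n
    proof -
      define z where "z = cocycle (n - m) (sdrop m \<gamma>) *v e"
      have z: "z $ a \<ge> 0" for a
        by (auto simp: z_def matrix_vector_mult_def e_def intro!: sum_nonneg cocycle_nonneg)
      have yz: "y n = cocycle m \<gamma> *v z"
        using cocycle_add[of m "n - m" \<gamma>] that
        by (simp add: y_def z_def matrix_vector_mul_assoc)
      have "d * s n = (\<Sum>a\<in>UNIV. d * w $ a * z $ a)"
        by (simp add: s_def yz flip: dot_lmul_matrix)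
          (simp add: w_def[symmetric] inner_vec_def sum_distrib_left mult.assoc)
      also have "\<dots> \<le> (\<Sum>a\<in>UNIV. u $ a * z $ a)"
        by (intro sum_mono mult_right_mono uw z)
      also have "\<dots> = v \<bullet> y n"
        by (simp add: yz flip: dot_lmul_matrix) (simp add: u_def[symmetric] inner_vec_def)
      finally show ?thesis
        using s_pos[of n] by (simp add: x_def field_simps)
    qed
    then have "eventually (\<lambda>n. d \<le> v \<bullet> (x \<circ> r) n) sequentially"
      using filterlim_subseq[OF r] unfolding filterlim_at_top comp_def
      by (auto elim!: allE[of _ m] eventually_mono)
    moreover have "(\<lambda>n. v \<bullet> (x \<circ> r) n) \<longlonglongrightarrow> v \<bullet> f"
      by (intro tendsto_intros lim)
    ultimately have "d \<le> v \<bullet> f"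
      by (intro tendsto_lowerbound) auto
    with v d show False by simp
  qed
  have "mixed_sign (v v* cocycle n \<gamma>)" if v: "v \<bullet> f = 0" for v n
  proof -
    have "(- v) v* cocycle n \<gamma> = - (v v* cocycle n \<gamma>)"
      by (simp add: vec_eq_iff vector_matrix_mult_def sum_negf)
    then show ?thesis
      using not_pos[OF v, of n] not_pos[of "- v" n] v by (simp add: mixed_sign_def)
  qed
  with f_bounds f_sum show thesis by (rule that)
qed

section \<open>Occurrences of the block and exponential decay of forms\<close>

definition block :: "2 stream \<Rightarrow> bool" where
  "block \<gamma> \<longleftrightarrow> \<gamma> \<in> cylinder [1, 2, 1, 2, 1, 2, 1, 2]"

lemma block_snth:
  assumes "block (sdrop n \<gamma>)"
  shows "\<gamma> !! n = 1" "\<gamma> !! Suc n = 2" "\<gamma> !! Suc (Suc n) = 1" "\<gamma> !! Suc (Suc (Suc n)) = 2"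
    "\<gamma> !! Suc (Suc (Suc (Suc n))) = 1"
proof -
  have "stake 8 (sdrop n \<gamma>) = [1, 2, 1, 2, 1, 2, 1, 2]"
    using assms by (simp add: block_def cylinder_def numeral_eq_Suc)
  then have nth: "k < 8 \<Longrightarrow> sdrop n \<gamma> !! k = [1, 2, 1, 2, 1, 2, 1, 2] ! k" for k
    by (metis stake_nth)
  show "\<gamma> !! n = 1" "\<gamma> !! Suc n = 2" "\<gamma> !! Suc (Suc n) = 1" "\<gamma> !! Suc (Suc (Suc n)) = 2"
    "\<gamma> !! Suc (Suc (Suc (Suc n))) = 1"
    using nth[of 0] nth[of 1] nth[of 2] nth[of 3] nth[of 4]
    by (simp_all add: sdrop_snth numeral_eq_Suc)
qed

text \<open>Reading \<open>12121\<close> from time \<open>n\<close> on carries the pair of times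
  \<open>n\<close>, \<open>n + 1\<close> to the pair \<open>n + 4\<close>, \<open>n + 5\<close>,
  whence the shift by 4.\<close>

lemma spread_vector_cocycle:
  fixes v \<gamma>
  defines "M \<equiv> \<lambda>n. max (spread (v v* cocycle n \<gamma>)) (spread (v v* cocycle (Suc n) \<gamma>))"
  assumes mixed: "\<And>n. mixed_sign (v v* cocycle n \<gamma>)"
  shows "M (Suc n) \<le> M n" "block (sdrop n \<gamma>) \<Longrightarrow> M (n + 4) \<le> 4/5 * M n"
proof -
  show "M (Suc n) \<le> M n"
    using spread_two_steps[of "v v* cocycle n \<gamma>" "\<gamma> !! n" "\<gamma> !! Suc n"] mixed[of "Suc n"]
    unfolding M_def vector_cocycle_Suc by simp
  assume "block (sdrop n \<gamma>)"
  note b = block_snth[OF this]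
  have "n + 4 = Suc (Suc (Suc (Suc n)))"
    by simp
  then show "M (n + 4) \<le> 4/5 * M n"
    using spread_five_steps[of "v v* cocycle n \<gamma>"] mixed[of "Suc (n + 4)"]
    unfolding M_def by (simp only: vector_cocycle_Suc b)
qed

definition block_count :: "nat \<Rightarrow> 2 stream \<Rightarrow> nat" where
  "block_count n \<gamma> = card {i. i < n \<and> block (sdrop i \<gamma>)}"

lemma block_count_Suc: "block_count (Suc n) \<gamma> = block_count n \<gamma> + (if block (sdrop n \<gamma>) then 1 else 0)"
proof -
  have "{i. i < Suc n \<and> block (sdrop i \<gamma>)} =
      (if block (sdrop n \<gamma>) then insert n {i. i < n \<and> block (sdrop i \<gamma>)} else {i. i < n \<and> block (sdrop i \<gamma>)})"
    by (auto simp: less_Suc_eq)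
  then show ?thesis
    by (simp add: block_count_def)
qed

definition frequent_blocks :: "real \<Rightarrow> 2 stream \<Rightarrow> bool" where
  "frequent_blocks p \<gamma> \<longleftrightarrow> (\<forall>\<^sub>F n in sequentially. p * real n \<le> real (block_count n \<gamma>))"

text \<open>Blocks of density \<open>p\<close> give the product of four consecutive values the rate
  \<open>(4/5) powr p\<close>; a single value gets its fourth root.\<close>

definition decay_rate :: "real \<Rightarrow> real" where
  "decay_rate p = (4/5) powr (p/4)"

lemma decay_rate_bounds: "0 < decay_rate p" "0 < p \<Longrightarrow> decay_rate p < 1"
  using powr_less_mono2[of "p/4" "4/5" 1] by (simp_all add: decay_rate_def)

text \<open>
  Since blocks may overlap, the product of four consecutive terms is considered: moving the window by
  one step replaces its first term by the one four steps later.
\<close>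

lemma window_product_decay:
  fixes M :: "nat \<Rightarrow> real"
  assumes nonneg: "\<And>n. 0 \<le> M n" and dec: "\<And>n. M (Suc n) \<le> M n"
    and block: "\<And>n. block (sdrop n \<gamma>) \<Longrightarrow> M (n + 4) \<le> 4/5 * M n"
  shows "M n * M (n + 1) * M (n + 2) * M (n + 3) \<le> (4/5) ^ block_count n \<gamma> * M 0 ^ 4"
proof (induction n)
  case 0
  have "M 1 \<le> M 0" "M 2 \<le> M 1" "M 3 \<le> M 2"
    using dec[of 0] dec[of 1] dec[of 2] by (simp_all add: numeral_eq_Suc)
  then have "M 0 * M 1 * M 2 * M 3 \<le> M 0 * M 0 * M 0 * M 0"
    by (intro mult_mono mult_nonneg_nonneg nonneg) linarith+
  then show ?case
    by (simp add: block_count_def power4_eq_xxxx numeral_2_eq_2 numeral_3_eq_3)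
next
  case (Suc n)
  define q :: real where "q = (if block (sdrop n \<gamma>) then 4/5 else 1)"
  have "M (n + 4) \<le> M n"
    using dec[of n] dec[of "Suc n"] dec[of "Suc (Suc n)"] dec[of "Suc (Suc (Suc n))"]
    by (simp add: numeral_eq_Suc)
  then have q: "M (n + 4) \<le> q * M n"
    using block[of n] by (simp add: q_def)
  have "M (Suc n) * M (Suc n + 1) * M (Suc n + 2) * M (Suc n + 3)
      = M (n + 1) * M (n + 2) * M (n + 3) * M (n + 4)"
    by (simp add: numeral_eq_Suc)
  also have "\<dots> \<le> M (n + 1) * M (n + 2) * M (n + 3) * (q * M n)"
    by (intro mult_left_mono q mult_nonneg_nonneg nonneg)
  also have "\<dots> = q * (M n * M (n + 1) * M (n + 2) * M (n + 3))"
    by (simp add: mult_ac)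
  also have "\<dots> \<le> q * ((4/5) ^ block_count n \<gamma> * M 0 ^ 4)"
    by (intro mult_left_mono Suc) (simp add: q_def)
  also have "\<dots> = (4/5) ^ block_count (Suc n) \<gamma> * M 0 ^ 4"
    by (simp add: q_def block_count_Suc)
  finally show ?case .
qed

lemma spread_decay:
  assumes freq: "frequent_blocks p \<gamma>" and mixed: "\<And>n. mixed_sign (v v* cocycle n \<gamma>)"
    and p: "0 < p"
  obtains K where "K \<ge> 0" "\<And>n. spread (v v* cocycle n \<gamma>) \<le> K * decay_rate p ^ n"
proof -
  define M where "M n = max (spread (v v* cocycle n \<gamma>)) (spread (v v* cocycle (Suc n) \<gamma>))" for n
  define r where "r = decay_rate p"
  have r: "0 < r" "r < 1"
    using decay_rate_bounds p by (auto simp: r_def)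
  have nonneg: "0 \<le> M n" for n
    by (simp add: M_def le_max_iff_disj spread_nonneg)
  have dec: "M (Suc n) \<le> M n" and block: "block (sdrop n \<gamma>) \<Longrightarrow> M (n + 4) \<le> 4/5 * M n" for n
    using spread_vector_cocycle[OF mixed] unfolding M_def by blast+
  have M_anti: "M n \<le> M m" if "m \<le> n" for m n
    using dec that by (rule lift_Suc_antimono_le)
  obtain N where N: "\<And>n. n \<ge> N \<Longrightarrow> p * real n \<le> real (block_count n \<gamma>)"
    using freq unfolding frequent_blocks_def eventually_sequentially by blast
  \<comment> \<open>\<open>M\<close> is antitone, so the fourth power of its value at the end of a
    window is at most the window product.\<close>
  have late: "M (n + 3) \<le> M 0 * r ^ n" if "n \<ge> N" for n
  proof -
    have "M (n + 3) ^ 4 = M (n + 3) * M (n + 3) * M (n + 3) * M (n + 3)"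
      by (simp add: power4_eq_xxxx)
    also have "\<dots> \<le> M n * M (n + 1) * M (n + 2) * M (n + 3)"
      by (intro mult_mono M_anti mult_nonneg_nonneg nonneg) auto
    also have "\<dots> \<le> (4/5) ^ block_count n \<gamma> * M 0 ^ 4"
      by (rule window_product_decay[OF nonneg dec block])
    also have "\<dots> \<le> (r ^ n) ^ 4 * M 0 ^ 4"
    proof (rule mult_right_mono)
      have "(4/5 :: real) ^ block_count n \<gamma> = (4/5) powr real (block_count n \<gamma>)"
        by (simp add: powr_realpow)
      also have "\<dots> \<le> (4/5) powr (p * real n)"
        using N[OF that] by (intro powr_mono') auto
      also have "\<dots> = (r ^ n) ^ 4"
        by (simp add: r_def decay_rate_def powr_power mult.commute flip: power_mult)
      finally show "(4/5) ^ block_count n \<gamma> \<le> (r ^ n) ^ 4" .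
    qed simp
    also have "\<dots> = (M 0 * r ^ n) ^ 4"
      by (simp add: power_mult_distrib)
    finally have "M (n + 3) ^ Suc 3 \<le> (M 0 * r ^ n) ^ Suc 3"
      by simp
    moreover have "0 \<le> M 0 * r ^ n"
      using r nonneg[of 0] by simp
    ultimately show ?thesis
      by (rule power_le_imp_le_base)
  qed
  \<comment> \<open>The denominator pays for the window length 3 and for the times before
    \<open>N + 3\<close>, where only \<open>M n \<le> M 0\<close> is available.\<close>
  define K where "K = M 0 / r ^ (N + 3)"
  have K: "K \<ge> 0"
    using nonneg[of 0] r by (simp add: K_def)
  have "M n \<le> K * r ^ n" for n
  proof (cases "n \<ge> N + 3")
    case True
    have "M n \<le> M 0 * r ^ (n - 3)"
      using late[of "n - 3"] True by simp
    also have "\<dots> \<le> M 0 * (r ^ n / r ^ (N + 3))"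
    proof (intro mult_left_mono nonneg)
      have "r ^ (n - 3) * r ^ (N + 3) = r ^ (n + N)"
        using True by (simp flip: power_add)
      also have "\<dots> \<le> r ^ n"
        using r by (intro power_decreasing) auto
      finally show "r ^ (n - 3) \<le> r ^ n / r ^ (N + 3)"
        using r by (simp add: field_simps)
    qed
    finally show ?thesis
      by (simp add: K_def)
  next
    case False
    have "M n \<le> M 0 * 1"
      using M_anti[of 0 n] by simp
    also have "\<dots> \<le> M 0 * (r ^ n / r ^ (N + 3))"
    proof (intro mult_left_mono nonneg)
      have "r ^ (N + 3) \<le> r ^ n"
        using r False by (intro power_decreasing) auto
      then show "1 \<le> r ^ n / r ^ (N + 3)"
        using r by (simp add: field_simps)
    qed
    finally show ?thesis
      by (simp add: K_def)
  qed
  moreover have "spread (v v* cocycle n \<gamma>) \<le> M n" for n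
    by (simp add: M_def)
  ultimately show thesis
    using K that[of K] unfolding r_def by (blast intro: order_trans)
qed

lemma frequent_blocks_infinitely_often:
  assumes "frequent_blocks p \<gamma>" "0 < p"
  obtains m where "m \<ge> N" "block (sdrop m \<gamma>)"
proof (rule ccontr)
  assume "\<not> thesis"
  with that have no: "\<not> block (sdrop m \<gamma>)" if "m \<ge> N" for m
    using \<open>m \<ge> N\<close> by blast
  have "block_count n \<gamma> \<le> N" for n
  proof -
    have "block_count n \<gamma> \<le> card {..<N}"
      unfolding block_count_def by (intro card_mono) (use no in \<open>auto simp: not_le[symmetric]\<close>)
    then show ?thesis by simp
  qed
  moreover obtain n0 where n0: "\<And>n. n \<ge> n0 \<Longrightarrow> p * real n \<le> real (block_count n \<gamma>)"
    using assms(1) unfolding frequent_blocks_def eventually_sequentially by blast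
  moreover obtain n1 :: nat where "real N / p < real n1"
    using reals_Archimedean2 by blast
  then have "real N < p * real n1"
    using assms(2) by (simp add: field_simps)
  moreover have "p * real n1 \<le> p * real (max n0 n1)"
    using assms(2) by simp
  ultimately show False
    by (smt (verit) max.cobounded1 of_nat_le_iff)
qed

section \<open>Ergodic theorems for bounded processes\<close>

locale ergodic_system = prob_space M for M :: "'a measure" +
  fixes T :: "'a \<Rightarrow> 'a"
  assumes T_measurable [measurable]: "T \<in> measurable M M"
    and distr_T: "distr M M T = M"
    and ergodic: "A \<in> sets M \<Longrightarrow> T -` A \<inter> space M = A \<Longrightarrow> prob A = 0 \<or> prob A = 1"
begin

lemma T_pow_measurable [measurable]: "T ^^ n \<in> measurable M M"
proof (induction n)
  case (Suc n)
  then show ?case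
    unfolding funpow.simps by (rule measurable_comp) (rule T_measurable)
qed (simp add: id_def)

lemma T_pow_space: "x \<in> space M \<Longrightarrow> (T ^^ n) x \<in> space M"
  by (rule measurable_space[OF T_pow_measurable])

lemma distr_T_pow: "distr M M (T ^^ n) = M"
proof (induction n)
  case 0
  then show ?case by (simp add: id_def distr_id)
next
  case (Suc n)
  have "distr M M (T ^^ Suc n) = distr (distr M M (T ^^ n)) M T"
    by (subst distr_distr) (auto simp: comp_def)
  then show ?case by (simp only: Suc distr_T)
qed

lemma prob_vimage_T_pow:
  assumes "A \<in> sets M"
  shows "prob ((T ^^ n) -` A \<inter> space M) = prob A"
  using measure_distr[OF T_pow_measurable assms, of n] by (simp add: distr_T_pow)

lemma integral_T_pow:
  assumes "f \<in> borel_measurable M"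
  shows "(\<integral>x. f ((T ^^ n) x) \<partial>M) = (\<integral>x. f x \<partial>M :: real)"
  using integral_distr[OF T_pow_measurable assms, of n] by (simp add: distr_T_pow)

text \<open>The preimages of \<open>B\<close> under the powers of \<open>T\<close> increase and all
  have the measure of \<open>B\<close>. Their union is invariant, so ergodicity applies to
  it.\<close>

lemma zero_one_law:
  assumes B: "B \<in> sets M" and sub: "B \<subseteq> T -` B"
  shows "prob B = 0 \<or> prob B = 1"
proof -
  define A where "A n = (T ^^ n) -` B \<inter> space M" for n
  have A_sets: "A n \<in> sets M" for n
    unfolding A_def by (rule measurable_sets[OF T_pow_measurable B])
  have "A n \<subseteq> A (Suc n)" for n
    using sub by (auto simp: A_def)
  then have inc: "incseq A"
    by (rule incseq_SucI)
  have "(\<lambda>n. prob (A n)) \<longlonglongrightarrow> prob (\<Union>n. A n)"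
    by (rule finite_Lim_measure_incseq) (use A_sets inc in auto)
  then have "prob (\<Union>n. A n) = prob B"
    by (simp add: A_def prob_vimage_T_pow B LIMSEQ_const_iff)
  moreover have "T -` (\<Union>n. A n) \<inter> space M = (\<Union>n. A n)"
  proof -
    have "T -` A n \<inter> space M = A (Suc n)" for n
      using measurable_space[OF T_measurable] by (auto simp: A_def funpow_swap1)
    then have "T -` (\<Union>n. A n) \<inter> space M = (\<Union>n. A (Suc n))"
      by blast
    also have "\<dots> = (\<Union>n. A n)"
    proof
      show "(\<Union>n. A n) \<subseteq> (\<Union>n. A (Suc n))"
        using incseq_SucD[OF inc] by blast
    qed auto
    finally show ?thesis .
  qed
  ultimately show ?thesis
    using ergodic[of "\<Union>n. A n"] A_sets by auto
qed

end

section \<open>Almost sure lower growth rate of a bounded subadditive process\<close>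

locale bounded_subadditive = ergodic_system M T for M :: "'a measure" and T +
  fixes g :: "nat \<Rightarrow> 'a \<Rightarrow> real" and C :: real
  assumes g_measurable [measurable]: "g n \<in> borel_measurable M"
    and subadditive:
      "x \<in> space M \<Longrightarrow> 0 < m \<Longrightarrow> 0 < n \<Longrightarrow> g (m + n) x \<le> g m x + g n ((T ^^ m) x)"
    and bounded: "x \<in> space M \<Longrightarrow> 0 < n \<Longrightarrow> \<bar>g n x\<bar> \<le> C * real n"
begin

text \<open>The points where the lower limit of \<open>g n x / n\<close> exceeds \<open>c\<close>;
  the countable form of the strict margin makes the set measurable.\<close>

definition growth_above :: "real \<Rightarrow> 'a set" where
  "growth_above c = {x \<in> space M. \<exists>k N. \<forall>n\<ge>N. (c + 1 / real (Suc k)) * real n < g n x}"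

lemma growth_above_sets [measurable]: "growth_above c \<in> sets M"
  unfolding growth_above_def by measurable

lemma growth_above_antimono: "c \<le> c' \<Longrightarrow> growth_above c' \<subseteq> growth_above c"
proof
  fix x assume c: "c \<le> c'" and "x \<in> growth_above c'"
  then obtain k N where x: "x \<in> space M"
    and *: "\<And>n. n \<ge> N \<Longrightarrow> (c' + 1 / real (Suc k)) * real n < g n x"
    unfolding growth_above_def by blast
  have "(c + 1 / real (Suc k)) * real n \<le> (c' + 1 / real (Suc k)) * real n" for n
    using c by (intro mult_right_mono) auto
  with x * show "x \<in> growth_above c"
    unfolding growth_above_def by (blast intro: le_less_trans)
qed

text \<open>Since \<open>g (Suc n) x\<close> is at most \<open>g 1 x + g n (T x)\<close>, the lower
  limit cannot decrease along an orbit. This one inclusion is what \<open>zero_one_law\<close> asks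
  for.\<close>

lemma growth_above_shift: "growth_above c \<subseteq> T -` growth_above c"
proof
  fix x assume "x \<in> growth_above c"
  then obtain k N where x: "x \<in> space M"
    and *: "\<And>n. n \<ge> N \<Longrightarrow> (c + 1 / real (Suc k)) * real n < g n x"
    unfolding growth_above_def by blast
  \<comment> \<open>The part of the margin that is given up; for large \<open>n\<close> it outweighs
    the error \<open>C + \<bar>c\<bar>\<close>.\<close>
  define d where "d = 1 / real (Suc k) - 1 / real (Suc (Suc k))"
  have d: "d > 0"
    by (simp add: d_def divide_simps)
  obtain N' :: nat where N': "(C + \<bar>c\<bar>) / d < real N'"
    using reals_Archimedean2 by blast
  have "(c + 1 / real (Suc (Suc k))) * real n < g n (T x)" if n: "n \<ge> max 1 (max N N')" for n
  proof -
    have "(C + \<bar>c\<bar>) / d < real n"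
      using N' n by auto
    then have "C + \<bar>c\<bar> < d * real n"
      using d by (simp add: field_simps)
    moreover have "(c + 1 / real (Suc k)) * real (Suc n) < g (Suc n) x"
      using n by (intro *) auto
    moreover have "g (Suc n) x \<le> C + g n (T x)"
      using subadditive[OF x, of 1 n] bounded[OF x, of 1] n by simp
    moreover have "(c + 1 / real (Suc k)) * real (Suc n)
        = (c + 1 / real (Suc (Suc k))) * real n + d * real n + c + 1 / real (Suc k)"
      by (simp add: d_def algebra_simps add_divide_distrib)
    moreover have "0 \<le> 1 / real (Suc k)"
      by simp
    ultimately show ?thesis
      by linarith
  qed
  then have "T x \<in> growth_above c"
    using measurable_space[OF T_measurable x] unfolding growth_above_def by blast
  then show "x \<in> T -` growth_above c"
    by simp
qed

text \<open>\<open>L\<close> is the almost sure lower limit: the supremum of the thresholds whose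
  set has full measure. The zero-one law excludes intermediate values, and the bound on
  \<open>g\<close> makes this set of thresholds nonempty and bounded above.\<close>

lemma growth_rate_exists:
  obtains L where "\<And>e. e > 0 \<Longrightarrow> prob (growth_above (L - e)) = 1"
    and "\<And>e. e > 0 \<Longrightarrow> prob (growth_above (L + e)) = 0"
proof -
  define S where "S = {c. prob (growth_above c) = 1}"
  have zo: "prob (growth_above c) = 0 \<or> prob (growth_above c) = 1" for c
    by (rule zero_one_law[OF growth_above_sets growth_above_shift])
  have down: "c \<in> S" if "c \<le> c'" "c' \<in> S" for c c'
  proof -
    have "prob (growth_above c') \<le> prob (growth_above c)"
      by (rule finite_measure_mono[OF growth_above_antimono[OF that(1)]]) simp
    with that(2) zo[of c] show ?thesis
      by (auto simp: S_def)
  qed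
  \<comment> \<open>The extra \<open>- 1\<close> leaves room for the margin
    \<open>1 / real (Suc 1)\<close>.\<close>
  have "growth_above (- C - 1) = space M"
  proof -
    have "(- C - 1 + 1 / real (Suc 1)) * real n < g n x" if "x \<in> space M" "n \<ge> 1" for x n
    proof -
      have "- (C * real n) \<le> g n x"
        using bounded[OF that(1), of n] that(2) by auto
      then show ?thesis
        using that(2) by (simp add: algebra_simps)
    qed
    then show ?thesis
      unfolding growth_above_def by blast
  qed
  then have ne: "- C - 1 \<in> S"
    by (simp add: S_def prob_space)
  have bdd: "c \<le> C" if "c \<in> S" for c
  proof (rule ccontr)
    assume c: "\<not> c \<le> C"
    from that have "growth_above c \<noteq> {}"
      by (auto simp: S_def)
    then obtain x k N where x: "x \<in> space M"
      and *: "\<And>n. n \<ge> N \<Longrightarrow> (c + 1 / real (Suc k)) * real n < g n x"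
      unfolding growth_above_def by blast
    have "(c + 1 / real (Suc k)) * real (Suc N) < C * real (Suc N)"
      using *[of "Suc N"] bounded[OF x, of "Suc N"] by linarith
    then have "c + 1 / real (Suc k) < C"
      by (rule mult_right_less_imp_less) (rule of_nat_0_le_iff)
    moreover have "0 \<le> 1 / real (Suc k)"
      by simp
    ultimately show False
      using c by linarith
  qed
  have neS: "S \<noteq> {}"
    using ne by blast
  have bddS: "bdd_above S"
    using bdd by (auto simp: bdd_above_def)
  have "prob (growth_above (Sup S - e)) = 1" if "e > 0" for e
  proof -
    have "Sup S - e < Sup S"
      using that by simp
    then obtain c where "c \<in> S" "Sup S - e < c"
      using less_cSupD[OF neS] by blast
    then show ?thesis
      using down[of "Sup S - e" c] by (simp add: S_def)
  qed
  moreover have "prob (growth_above (Sup S + e)) = 0" if "e > 0" for e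
    using cSup_upper[OF _ bddS, of "Sup S + e"] that zo[of "Sup S + e"] by (auto simp: S_def)
  ultimately show thesis
    by (rule that)
qed

text \<open>
  Cut the orbit segment of length \<open>n\<close> greedily into blocks of length at most \<open>N\<close> on which the growth
  is at most \<open>L\<close>; steps of length one remain at the visits to \<open>B\<close>, and a last block shorter than \<open>N\<close>.
\<close>

lemma greedy_bound:
  assumes N: "1 \<le> N" and K: "0 \<le> K" "C - L \<le> K"
    and good: "\<And>y. y \<in> space M \<Longrightarrow> y \<notin> B \<Longrightarrow> \<exists>k\<in>{1..N}. g k y \<le> L * real k"
    and "0 < n" "x \<in> space M"
  shows "g n x \<le> L * real n + K * (\<Sum>i<n. indicator B ((T ^^ i) x)) + K * real N"
  using \<open>0 < n\<close> \<open>x \<in> space M\<close>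
proof (induction n arbitrary: x rule: less_induct)
  case (less n x)
  define S where "S n x = (\<Sum>i<n. indicator B ((T ^^ i) x) :: real)" for n x
  have S_nonneg: "S n x \<ge> 0" for n x
    by (auto simp: S_def intro!: sum_nonneg)
  have S_split: "S (k + m) x = S k x + S m ((T ^^ k) x)" for k m x
  proof -
    have "S (k + m) x = S k x + (\<Sum>i = k..<k + m. indicator B ((T ^^ i) x))"
      unfolding S_def lessThan_atLeast0 by (rule sum.atLeastLessThan_concat[symmetric]) auto
    also have "(\<Sum>i = k..<k + m. indicator B ((T ^^ i) x) :: real) = S m ((T ^^ k) x)"
      unfolding S_def lessThan_atLeast0
      using sum.shift_bounds_nat_ivl[of "\<lambda>i. indicator B ((T ^^ i) x) :: real" 0 k m]
      by (simp add: add.commute[of k] funpow_add)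
    finally show ?thesis .
  qed
  show ?case
  proof (cases "n \<le> N")
    case True
    have "g n x \<le> C * real n"
      using bounded[OF less.prems(2,1)] by simp
    also have "\<dots> \<le> L * real n + K * real n"
      using mult_right_mono[OF K(2), of "real n"] by (simp add: algebra_simps)
    also have "\<dots> \<le> L * real n + K * real N"
      using True K(1) by (simp add: mult_left_mono)
    finally show ?thesis
      using mult_nonneg_nonneg[OF K(1) S_nonneg[of n x]] by (simp add: S_def)
  next
    case False
    \<comment> \<open>The first piece: a single step at a visit to \<open>B\<close>, whose excess
      over \<open>L\<close> is at most \<open>K\<close>, or a good block, which is shorter than
      \<open>n\<close> because \<open>N < n\<close>.\<close>
    have "\<exists>k. 0 < k \<and> k < n \<and> g k x \<le> L * real k + K * S k x"
    proof (cases "x \<in> B")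
      case True
      have "g 1 x \<le> L + K"
        using bounded[OF less.prems(2), of 1] K(2) by simp
      with N \<open>\<not> n \<le> N\<close> True show ?thesis
        by (intro exI[of _ 1]) (simp add: S_def)
    next
      case False
      then obtain k where "k \<in> {1..N}" "g k x \<le> L * real k"
        using good[OF less.prems(2)] by blast
      then show ?thesis
        using \<open>\<not> n \<le> N\<close> mult_nonneg_nonneg[OF K(1) S_nonneg[of k x]]
        by (intro exI[of _ k]) auto
    qed
    then obtain k where k: "0 < k" "k < n" "g k x \<le> L * real k + K * S k x"
      by blast
    have "g n x \<le> g k x + g (n - k) ((T ^^ k) x)"
      using subadditive[OF less.prems(2), of k "n - k"] k by simp
    also have "g (n - k) ((T ^^ k) x) \<le> L * real (n - k) + K * S (n - k) ((T ^^ k) x) + K * real N"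
      unfolding S_def using k by (intro less.IH) (auto simp: T_pow_space less.prems)
    finally have "g n x \<le> L * (real k + real (n - k)) + K * (S k x + S (n - k) ((T ^^ k) x)) + K * real N"
      using k(3) by (simp add: algebra_simps)
    then show ?thesis
      using S_split[of k "n - k" x] k by (simp add: S_def)
  qed
qed


text \<open>The common source of both ergodic theorems below. It is important that \<open>K\<close>
  does not depend on \<open>e\<close>, so that the visits to \<open>B\<close> cost little when
  \<open>e\<close> is small.\<close>

lemma exceptional_set:
  obtains K L where "K \<ge> 0"
    and "\<And>e. e > 0 \<Longrightarrow> AE x in M. eventually (\<lambda>n. (L - e) * real n \<le> g n x) sequentially"
    and "\<And>e. e > 0 \<Longrightarrow> \<exists>B N. B \<in> sets M \<and> prob B < e \<and>
      (\<forall>x\<in>space M. \<forall>n>0. g n x \<le>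
        (L + e) * real n + K * (\<Sum>i<n. indicator B ((T ^^ i) x)) + K * real N)"
proof -
  obtain L where L1: "\<And>e. e > 0 \<Longrightarrow> prob (growth_above (L - e)) = 1"
    and L0: "\<And>e. e > 0 \<Longrightarrow> prob (growth_above (L + e)) = 0"
    using growth_rate_exists by blast
  define K where "K = max 0 (C - L)"
  have K: "K \<ge> 0" "C - L \<le> K"
    by (auto simp: K_def)
  have lower: "AE x in M. eventually (\<lambda>n. (L - e) * real n \<le> g n x) sequentially" if "e > 0" for e
  proof -
    have "AE x in M. x \<in> growth_above (L - e)"
      using L1[OF that] prob_eq_1[OF growth_above_sets] by blast
    then show ?thesis
    proof eventually_elim
      case (elim x)
      then obtain k N where *: "\<And>n. n \<ge> N \<Longrightarrow> (L - e + 1 / real (Suc k)) * real n < g n x"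
        unfolding growth_above_def by blast
      have "(L - e) * real n \<le> g n x" if "n \<ge> N" for n
      proof -
        have "(L - e) * real n \<le> (L - e + 1 / real (Suc k)) * real n"
          by (intro mult_right_mono) auto
        with *[OF that] show ?thesis by linarith
      qed
      then show ?case
        unfolding eventually_sequentially by blast
    qed
  qed
  have upper: "\<exists>B N. B \<in> sets M \<and> prob B < e \<and>
      (\<forall>x\<in>space M. \<forall>n>0. g n x \<le>
        (L + e) * real n + K * (\<Sum>i<n. indicator B ((T ^^ i) x)) + K * real N)" if e: "e > 0" for e
  proof -
    \<comment> \<open>Outside \<open>B N\<close> some block of length at most \<open>N\<close> grows
      at rate at most \<open>L + e\<close>, as \<open>greedy_bound\<close> requires.\<close>
    define B where "B N = {x \<in> space M. \<forall>k\<in>{1..N}. (L + e) * real k < g k x}" for N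
    have B_sets: "B N \<in> sets M" for N
      unfolding B_def by measurable
    have "decseq B"
      by (rule decseq_SucI) (auto simp: B_def)
    then have "(\<lambda>N. prob (B N)) \<longlonglongrightarrow> prob (\<Inter>N. B N)"
      by (intro finite_Lim_measure_decseq) (use B_sets in auto)
    \<comment> \<open>A point in every \<open>B N\<close> has growth above \<open>L + e\<close> at
      all positive times; comparing with \<open>L + e / 2\<close> provides the strict
      margin.\<close>
    moreover have "(\<Inter>N. B N) \<subseteq> growth_above (L + e / 2)"
    proof
      fix x assume x: "x \<in> (\<Inter>N. B N)"
      obtain k where "1 / real (Suc k) < e / 2"
        using e nat_approx_posE[of "e / 2"] by auto
      then have "(L + e / 2 + 1 / real (Suc k)) * real n < (L + e) * real n" if "n \<ge> 1" for n
        using that by (intro mult_strict_right_mono) auto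
      moreover have "(L + e) * real n < g n x" if "n \<ge> 1" for n
      proof -
        have "x \<in> B n"
          using x by blast
        with that show ?thesis by (simp add: B_def)
      qed
      ultimately have "\<forall>n\<ge>1. (L + e / 2 + 1 / real (Suc k)) * real n < g n x"
        by (blast intro: less_trans)
      moreover have "x \<in> space M"
        using x by (auto simp: B_def)
      ultimately show "x \<in> growth_above (L + e / 2)"
        unfolding growth_above_def by blast
    qed
    then have "prob (\<Inter>N. B N) \<le> prob (growth_above (L + e / 2))"
      by (rule finite_measure_mono) simp
    then have "prob (\<Inter>N. B N) = 0"
      using L0[of "e / 2"] e by (simp add: measure_le_0_iff)
    ultimately have "(\<lambda>N. prob (B N)) \<longlonglongrightarrow> 0"
      by simp
    then have "eventually (\<lambda>N. prob (B N) < e) sequentially"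
      using e by (rule order_tendstoD)
    then obtain N0 where N0: "\<And>N. N \<ge> N0 \<Longrightarrow> prob (B N) < e"
      unfolding eventually_sequentially by blast
    define N where "N = max 1 N0"
    have "\<exists>k\<in>{1..N}. g k y \<le> (L + e) * real k" if "y \<in> space M" "y \<notin> B N" for y
      using that by (auto simp: B_def not_less)
    then have "g n x \<le> (L + e) * real n + K * (\<Sum>i<n. indicator (B N) ((T ^^ i) x)) + K * real N"
      if "x \<in> space M" "n > 0" for x n
      using K e that by (intro greedy_bound) (auto simp: N_def)
    moreover have "prob (B N) < e"
      by (rule N0) (simp add: N_def)
    ultimately show ?thesis
      using B_sets by blast
  qed
  show thesis
    by (rule that[OF K(1) lower upper])
qed

end

section \<open>Birkhoff's lower bound and the subadditive ergodic theorem\<close>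

lemma (in ergodic_system) birkhoff_lower:
  fixes f :: "'a \<Rightarrow> real"
  assumes f [measurable]: "f \<in> borel_measurable M" and bound: "\<And>x. x \<in> space M \<Longrightarrow> \<bar>f x\<bar> \<le> C"
    and e: "e > 0"
  shows "AE x in M. eventually (\<lambda>n. ((\<integral>x. f x \<partial>M) - e) * real n \<le> (\<Sum>i<n. f ((T ^^ i) x))) sequentially"
proof -
  \<comment> \<open>Birkhoff sums are additive, so the subadditive machinery applies. It then
    suffices to show that its rate \<open>L\<close> is at least the integral of
    \<open>f\<close>.\<close>
  define g where "g n x = (\<Sum>i<n. f ((T ^^ i) x))" for n x
  interpret bounded_subadditive M T g C
  proof
    fix n show "g n \<in> borel_measurable M"
      unfolding g_def by measurable
  next
    fix x m n assume "x \<in> space M"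
    have "g (m + n) x = g m x + (\<Sum>i = m..<m + n. f ((T ^^ i) x))"
      unfolding g_def lessThan_atLeast0 by (rule sum.atLeastLessThan_concat[symmetric]) auto
    also have "(\<Sum>i = m..<m + n. f ((T ^^ i) x)) = g n ((T ^^ m) x)"
      unfolding g_def lessThan_atLeast0
      using sum.shift_bounds_nat_ivl[of "\<lambda>i. f ((T ^^ i) x)" 0 m n]
      by (simp add: add.commute[of m] funpow_add)
    finally show "g (m + n) x \<le> g m x + g n ((T ^^ m) x)" by simp
  next
    fix x n assume x: "x \<in> space M"
    have "\<bar>g n x\<bar> \<le> (\<Sum>i<n. C)"
      unfolding g_def by (rule order_trans[OF sum_abs sum_mono]) (auto intro!: bound T_pow_space x)
    then show "\<bar>g n x\<bar> \<le> C * real n"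
      by (simp add: mult.commute)
  qed
  obtain L K where K: "K \<ge> 0"
    and lower: "\<And>e. e > 0 \<Longrightarrow> AE x in M. eventually (\<lambda>n. (L - e) * real n \<le> g n x) sequentially"
    and upper: "\<And>e. e > 0 \<Longrightarrow> \<exists>B N. B \<in> sets M \<and> prob B < e \<and>
      (\<forall>x\<in>space M. \<forall>n>0. g n x \<le>
        (L + e) * real n + K * (\<Sum>i<n. indicator B ((T ^^ i) x)) + K * real N)"
    by (rule exceptional_set) (rule that)
  define J where "J = (\<integral>x. f x \<partial>M)"
  have f_int: "integrable M f"
    by (rule integrable_const_bound[where B = C]) (auto intro!: AE_I2 bound)
  have f_T_int: "integrable M (\<lambda>x. f ((T ^^ i) x))" for i
    by (rule integrable_const_bound[where B = C]) (auto intro!: AE_I2 bound T_pow_space)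
  have "J \<le> L"
  proof (rule field_le_epsilon)
    fix e :: real assume e: "e > 0"
    \<comment> \<open>The errors below add up to \<open>d + K * d + d\<close>, which is at most
      \<open>2 * (1 + K) * d = e\<close>.\<close>
    define d where "d = e / (2 * (1 + K))"
    have d: "d > 0"
      using e K by (simp add: d_def)
    obtain B N where B [measurable]: "B \<in> sets M" and "prob B < d"
      and *: "\<And>x n. x \<in> space M \<Longrightarrow> n > 0 \<Longrightarrow> g n x \<le>
        (L + d) * real n + K * (\<Sum>i<n. indicator B ((T ^^ i) x)) + K * real N"
      using upper[OF d] by blast
    have ind_int: "integrable M (\<lambda>x. indicator B ((T ^^ i) x) :: real)" for i
      by (rule integrable_const_bound[where B = 1]) (auto simp: indicator_def)
    have ind: "(\<integral>x. indicator B ((T ^^ i) x) \<partial>M) = prob B" for i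
      by (subst integral_T_pow) (auto simp: Int_absorb2 sets.sets_into_space)
    \<comment> \<open>Integrate the pointwise bound: by invariance each term of the Birkhoff sum has
      integral \<open>J\<close> and each visit indicator has integral \<open>prob B\<close>.\<close>
    have main: "J * real n \<le> (L + d) * real n + K * (real n * prob B) + K * real N" if "n > 0" for n
    proof -
      have "J * real n = (\<integral>x. g n x \<partial>M)"
        by (simp add: g_def f_T_int integral_T_pow J_def)
      also have "\<dots> \<le> (\<integral>x. (L + d) * real n + K * (\<Sum>i<n. indicator B ((T ^^ i) x)) + K * real N \<partial>M)"
        using * that by (intro integral_mono) (auto simp: g_def f_T_int ind_int)
      also have "\<dots> = (L + d) * real n + K * (real n * prob B) + K * real N"
        by (simp add: ind_int ind prob_space)
      finally show ?thesis .
    qed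
    obtain n :: nat where n: "K * real N / d < real n" "n > 0"
      using reals_Archimedean2[of "K * real N / d"] K d
      by (metis divide_nonneg_pos le_less_trans mult_nonneg_nonneg of_nat_0_le_iff of_nat_0_less_iff)
    have "K * real N \<le> d * real n"
      using n d by (simp add: field_simps)
    moreover have "K * (real n * prob B) \<le> K * (real n * d)"
      using K \<open>prob B < d\<close> by (intro mult_left_mono) auto
    ultimately have "J * real n \<le> (L + d + K * d + d) * real n"
      using main[OF n(2)] by (simp add: algebra_simps)
    then have "J \<le> L + d + K * d + d"
      using n by simp
    also have "\<dots> \<le> L + 2 * (1 + K) * d"
      using K d by (simp add: algebra_simps)
    also have "\<dots> = L + e"
      using K by (simp add: d_def)
    finally show "J \<le> L + e" .
  qed
  then have le: "(J - e) * real n \<le> (L - e) * real n" for n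
    by (simp add: mult_right_mono)
  show ?thesis
    using lower[OF e]
  proof eventually_elim
    case (elim x)
    then show ?case
      unfolding J_def[symmetric] g_def[symmetric]
      by eventually_elim (rule order_trans[OF le])
  qed
qed

lemma (in bounded_subadditive) subadditive_ergodic_theorem:
  obtains L where "AE x in M. (\<lambda>n. g n x / real n) \<longlonglongrightarrow> L"
proof -
  obtain L K where K: "K \<ge> 0"
    and lower: "\<And>e. e > 0 \<Longrightarrow> AE x in M. eventually (\<lambda>n. (L - e) * real n \<le> g n x) sequentially"
    and upper: "\<And>e. e > 0 \<Longrightarrow> \<exists>B N. B \<in> sets M \<and> prob B < e \<and>
      (\<forall>x\<in>space M. \<forall>n>0. g n x \<le>
        (L + e) * real n + K * (\<Sum>i<n. indicator B ((T ^^ i) x)) + K * real N)"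
    by (rule exceptional_set) (rule that)
  have upper': "AE x in M. eventually (\<lambda>n. g n x \<le> (L + e) * real n) sequentially" if e: "e > 0" for e
  proof -
    \<comment> \<open>The errors are \<open>d\<close> from the rate, \<open>2 * d * K\<close> from
      the visits to \<open>B\<close> and \<open>d\<close> from the constant
      \<open>K * real N\<close>.\<close>
    define d where "d = e / (2 + 2 * K)"
    have d: "d > 0"
      using e K by (simp add: d_def)
    obtain B N where B [measurable]: "B \<in> sets M" and pB: "prob B < d"
      and *: "\<And>x n. x \<in> space M \<Longrightarrow> n > 0 \<Longrightarrow> g n x \<le>
        (L + d) * real n + K * (\<Sum>i<n. indicator B ((T ^^ i) x)) + K * real N"
      using upper[OF d] by blast
    \<comment> \<open>The lower bound for \<open>- indicator B\<close> is an upper bound for the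
      number of visits to \<open>B\<close>.\<close>
    have "AE x in M. eventually (\<lambda>n. ((\<integral>x. - indicator B x \<partial>M) - d) * real n
        \<le> (\<Sum>i<n. - indicator B ((T ^^ i) x))) sequentially"
      by (rule birkhoff_lower[where C = 1]) (auto simp: d indicator_def)
    then have "AE x in M. x \<in> space M \<and> eventually (\<lambda>n. (\<Sum>i<n. indicator B ((T ^^ i) x))
        \<le> (prob B + d) * real n) sequentially"
      using AE_space
      by eventually_elim
        (auto simp: sum_negf Int_absorb2 sets.sets_into_space algebra_simps elim!: eventually_mono)
    then show ?thesis
    proof eventually_elim
      case (elim x)
      then have x: "x \<in> space M" and ev: "eventually (\<lambda>n. (\<Sum>i<n. indicator B ((T ^^ i) x))
          \<le> (prob B + d) * real n) sequentially"
        by auto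
      obtain n0 :: nat where n0: "K * real N / d < real n0"
        using reals_Archimedean2 by blast
      show ?case
        using ev eventually_ge_at_top[of "max 1 n0"]
      proof eventually_elim
        case (elim n)
        have "K * real N / d < real n"
          using n0 elim by auto
        then have "K * real N \<le> d * real n"
          using d by (simp add: field_simps)
        moreover have "K * (\<Sum>i<n. indicator B ((T ^^ i) x)) \<le> K * (2 * d * real n)"
        proof (rule mult_left_mono[OF _ K])
          have "(prob B + d) * real n \<le> 2 * d * real n"
            using pB by (intro mult_right_mono) auto
          with elim show "(\<Sum>i<n. indicator B ((T ^^ i) x)) \<le> 2 * d * real n"
            by linarith
        qed
        ultimately have "g n x \<le> (L + d) * real n + K * (2 * d * real n) + d * real n"
          using *[OF x, of n] elim by fastforce
        also have "\<dots> = (L + (2 + 2 * K) * d) * real n"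
          by (simp add: algebra_simps)
        also have "(2 + 2 * K) * d = e"
          using K by (simp add: d_def)
        finally show ?case .
      qed
    qed
  qed
  \<comment> \<open>Restricting to the tolerances \<open>1 / real (Suc k)\<close> leaves countably
    many null sets.\<close>
  have "AE x in M. \<forall>k. eventually (\<lambda>n. \<bar>g n x - L * real n\<bar> \<le> 1 / real (Suc k) * real n) sequentially"
    unfolding AE_all_countable
  proof
    fix k
    have "1 / real (Suc k) > 0" by simp
    from lower[OF this] upper'[OF this]
    show "AE x in M. eventually (\<lambda>n. \<bar>g n x - L * real n\<bar> \<le> 1 / real (Suc k) * real n) sequentially"
    proof eventually_elim
      case (elim x)
      then show ?case
        by eventually_elim (simp add: algebra_simps abs_le_iff)
    qed
  qed
  then have "AE x in M. (\<lambda>n. g n x / real n) \<longlonglongrightarrow> L"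
  proof eventually_elim
    case (elim x)
    show ?case
    proof (rule tendstoI)
      fix e :: real assume "e > 0"
      then obtain k where k: "1 / real (Suc k) < e"
        using nat_approx_posE by blast
      show "eventually (\<lambda>n. dist (g n x / real n) L < e) sequentially"
        using elim[rule_format, of k] eventually_gt_at_top[of 0]
      proof eventually_elim
        case (elim n)
        have "g n x / real n - L = (g n x - L * real n) / real n"
          using elim(2) by (simp add: field_simps)
        then have "\<bar>g n x / real n - L\<bar> = \<bar>g n x - L * real n\<bar> / real n"
          by simp
        also have "\<dots> \<le> 1 / real (Suc k)"
          using elim by (simp add: divide_simps)
        finally show ?case
          using k by (simp add: dist_real_def)
      qed
    qed
  qed
  then show thesis by (rule that)
qed

section \<open>Norms of exterior powers\<close>

lemma finite_ext_entries:
  "finite {\<bar>ext_entry A I J\<bar> | I J. I \<in> ext_basis k \<and> J \<in> ext_basis k}"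
proof -
  have "{\<bar>ext_entry A I J\<bar> | I J. I \<in> ext_basis k \<and> J \<in> ext_basis k}
      = (\<lambda>(I, J). \<bar>ext_entry A I J\<bar>) ` (ext_basis k \<times> ext_basis k)"
    by auto
  then show ?thesis
    by (simp add: finite_ext_basis)
qed

lemma ext_entry_le_ext_norm:
  assumes "I \<in> ext_basis k" "J \<in> ext_basis k"
  shows "\<bar>ext_entry A I J\<bar> \<le> ext_norm k A"
  unfolding ext_norm_def using assms by (intro Max_ge finite_ext_entries) auto

lemma ext_norm_leI:
  fixes A :: "real^'n::{finite,linorder}^'n::{finite,linorder}"
  assumes "ext_basis k \<noteq> ({} :: 'n list set)"
    and "\<And>I J. I \<in> ext_basis k \<Longrightarrow> J \<in> ext_basis k \<Longrightarrow> \<bar>ext_entry A I J\<bar> \<le> b"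
  shows "ext_norm k A \<le> b"
proof -
  have "{\<bar>ext_entry A I J\<bar> | I J. I \<in> ext_basis k \<and> J \<in> ext_basis k} \<noteq> {}"
    using assms(1) by blast
  then show ?thesis
    unfolding ext_norm_def using assms(2) by (intro Max.boundedI finite_ext_entries) auto
qed

section \<open>Exterior powers of order one, two and three as entries, minors and
  determinant\<close>

lemma ext_basis_1: "ext_basis 1 = range (\<lambda>i. [i])"
  by (auto simp: ext_basis_def length_Suc_conv)

lemma ext_basis_2: "ext_basis 2 = {[i, j] | i j. i < j}"
  by (auto simp: ext_basis_def numeral_2_eq_2 length_Suc_conv)

lemma less_3_iff: "(i::3) < j \<longleftrightarrow> (i = 3 \<and> j = 1) \<or> (i = 3 \<and> j = 2) \<or> (i = 1 \<and> j = 2)"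
proof -
  have "\<forall>i j. (i::3) < j \<longleftrightarrow> (i = 3 \<and> j = 1) \<or> (i = 3 \<and> j = 2) \<or> (i = 1 \<and> j = 2)"
    unfolding forall_3 by (simp add: less_bit1_def bit1.Rep_numeral bit1.Rep_1 bit1.Rep_0)
  then show ?thesis by blast
qed

lemma ext_basis_3: "ext_basis 3 = {[3, 1, 2 :: 3]}"
proof -
  have "i < j \<and> j < k \<longleftrightarrow> i = 3 \<and> j = 1 \<and> k = 2" for i j k :: 3
    unfolding less_3_iff by auto
  then have "sorted_wrt (<) [i, j, k] \<longleftrightarrow> [i, j, k] = [3, 1, 2]" for i j k :: 3
    by (auto intro: less_trans)
  then show ?thesis
    by (auto simp: ext_basis_def numeral_3_eq_3 length_Suc_conv simp del: sorted_wrt.simps)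
qed

lemma ext_entry_pair:
  "ext_entry A [i, j] [k, l] = A $ i $ k * A $ j $ l - A $ i $ l * A $ j $ k"
proof -
  have set2: "{..<length [i, j]} = {0, 1::nat}"
    by auto
  have f: "finite {1::nat}" "0 \<notin> {1::nat}"
    by auto
  show ?thesis
    unfolding ext_entry_def set2 sum_over_permutations_insert[OF f] permutes_sing
    by (simp add: set2[simplified] sign_swap_id sign_id swap_id_eq numeral_2_eq_2 lessThan_Suc)
qed

text \<open>Rows and columns are reordered simultaneously, which leaves the determinant
  unchanged.\<close>

lemma ext_entry_triple:
  fixes A :: "real^3^3"
  shows "ext_entry A [3, 1, 2] [3, 1, 2] = det A"
proof -
  have set3: "{..<length [3, 1, 2 :: 3]} = {0, 1, 2::nat}"
    by auto
  have f12: "finite {1::nat, 2}" "0 \<notin> {1::nat, 2}"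
    by auto
  have f2: "finite {2::nat}" "1 \<notin> {2::nat}"
    by auto
  show ?thesis
    unfolding ext_entry_def set3 sum_over_permutations_insert[OF f12]
      sum_over_permutations_insert[OF f2] permutes_sing
    by (simp add: set3[simplified] sign_swap_id permutation_swap_id sign_compose sign_id swap_id_eq
        numeral_3_eq_3 numeral_2_eq_2 lessThan_Suc det_3)
qed

lemma ext_norm_3: "ext_norm 3 (A :: real^3^3) = \<bar>det A\<bar>"
  by (simp add: ext_norm_def ext_basis_3 ext_entry_triple)

lemma abs_entry_le_ext_norm_1: "\<bar>A $ i $ j\<bar> \<le> ext_norm 1 A"
  using ext_entry_le_ext_norm[of "[i]" 1 "[j]" A] by (simp add: ext_basis_1[unfolded One_nat_def] ext_entry_singleton)

lemma ext_norm_1_leI: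
  assumes "\<And>i j. \<bar>A $ i $ j\<bar> \<le> b"
  shows "ext_norm 1 A \<le> b"
  by (rule ext_norm_leI) (use assms in \<open>auto simp: ext_basis_1[unfolded One_nat_def] ext_entry_singleton\<close>)

lemma ext_norm_1_nonneg: "ext_norm 1 A \<ge> 0"
  using abs_entry_le_ext_norm_1 abs_ge_zero by (rule order_trans[rotated])

lemma ext_norm_2_leI:
  fixes A :: "real^3^3"
  assumes "\<And>i j k l. i < j \<Longrightarrow> k < l \<Longrightarrow> \<bar>A $ i $ k * A $ j $ l - A $ i $ l * A $ j $ k\<bar> \<le> b"
  shows "ext_norm 2 A \<le> b"
proof (rule ext_norm_leI)
  have "[3, 1] \<in> (ext_basis 2 :: 3 list set)"
    by (simp add: ext_basis_2 less_3_iff)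
  then show "ext_basis 2 \<noteq> ({} :: 3 list set)"
    by blast
qed (use assms in \<open>auto simp: ext_basis_2 ext_entry_pair\<close>)

lemma ext_norm_2_nonneg: "ext_norm 2 (A :: real^3^3) \<ge> 0"
proof -
  have "[3, 1] \<in> (ext_basis 2 :: 3 list set)"
    by (simp add: ext_basis_2 less_3_iff)
  from ext_entry_le_ext_norm[OF this this, of A] show ?thesis
    by linarith
qed

text \<open>Interchanging rows or columns only changes the sign of a minor, and equal indices make
  it zero, so the increasing pairs of \<open>ext_basis\<close> suffice.\<close>

lemma minor_le_ext_norm_2:
  fixes A :: "real^3^3"
  shows "\<bar>A $ i $ k * A $ j $ l - A $ i $ l * A $ j $ k\<bar> \<le> ext_norm 2 A"
proof -
  have ordered: "\<bar>A $ i $ k * A $ j $ l - A $ i $ l * A $ j $ k\<bar> \<le> ext_norm 2 A"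
    if "i < j" "k < l" for i j k l
    using ext_entry_le_ext_norm[of "[i, j]" 2 "[k, l]" A] that
    by (simp add: ext_basis_2 ext_entry_pair)
  have swap: "\<bar>A $ i $ k * A $ j $ l - A $ i $ l * A $ j $ k\<bar> = \<bar>A $ j $ k * A $ i $ l - A $ j $ l * A $ i $ k\<bar>"
    "\<bar>A $ i $ k * A $ j $ l - A $ i $ l * A $ j $ k\<bar> = \<bar>A $ i $ l * A $ j $ k - A $ i $ k * A $ j $ l\<bar>" for i j k l
    by (simp_all add: mult.commute abs_minus_commute)
  show ?thesis
  proof (cases i j rule: linorder_cases)
    case less
    then show ?thesis
      using ordered[of i j k l] ordered[of i j l k] swap(2)[of i k j l] ext_norm_2_nonneg[of A]
      by (cases k l rule: linorder_cases) simp_all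
  next
    case equal
    then show ?thesis
      by (simp add: ext_norm_2_nonneg)
  next
    case greater
    then show ?thesis
      using ordered[of j i k l] ordered[of j i l k] swap(2)[of i k j l] swap(1)[of i k j l] swap(1)[of i l j k]
        ext_norm_2_nonneg[of A]
      by (cases k l rule: linorder_cases) simp_all
  qed
qed

section \<open>Norm inequalities for products and cofactors\<close>

lemma ext_norm_1_mult: "ext_norm 1 (A ** B) \<le> 3 * ext_norm 1 A * ext_norm 1 (B :: real^3^3)"
proof (rule ext_norm_1_leI)
  fix i j
  have "\<bar>(A ** B) $ i $ j\<bar> \<le> (\<Sum>k\<in>UNIV. \<bar>A $ i $ k * B $ k $ j\<bar>)"
    unfolding matrix_matrix_mult_def by simp
  also have "\<dots> \<le> (\<Sum>k\<in>(UNIV :: 3 set). ext_norm 1 A * ext_norm 1 B)"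
    unfolding abs_mult
    by (intro sum_mono mult_mono abs_entry_le_ext_norm_1 ext_norm_1_nonneg abs_ge_zero)
  finally show "\<bar>(A ** B) $ i $ j\<bar> \<le> 3 * ext_norm 1 A * ext_norm 1 B"
    by simp
qed

text \<open>Multiplicativity of the second exterior power. The three terms belong to the three index
  pairs, whence the factor 3 in \<open>ext_norm_2_mult\<close>.\<close>

lemma cauchy_binet_minor:
  fixes A B :: "real^3^3"
  shows "(A ** B) $ i $ k * (A ** B) $ j $ l - (A ** B) $ i $ l * (A ** B) $ j $ k =
     (A $ i $ 1 * A $ j $ 2 - A $ i $ 2 * A $ j $ 1) * (B $ 1 $ k * B $ 2 $ l - B $ 1 $ l * B $ 2 $ k)
   + (A $ i $ 1 * A $ j $ 3 - A $ i $ 3 * A $ j $ 1) * (B $ 1 $ k * B $ 3 $ l - B $ 1 $ l * B $ 3 $ k)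
   + (A $ i $ 2 * A $ j $ 3 - A $ i $ 3 * A $ j $ 2) * (B $ 2 $ k * B $ 3 $ l - B $ 2 $ l * B $ 3 $ k)"
  unfolding matrix_matrix_mult_def vec_lambda_beta sum_3 by algebra

lemma ext_norm_2_mult: "ext_norm 2 (A ** B) \<le> 3 * ext_norm 2 A * ext_norm 2 (B :: real^3^3)"
proof (rule ext_norm_2_leI)
  fix i j k l :: 3
  have "\<bar>(A ** B) $ i $ k * (A ** B) $ j $ l - (A ** B) $ i $ l * (A ** B) $ j $ k\<bar>
      \<le> ext_norm 2 A * ext_norm 2 B + ext_norm 2 A * ext_norm 2 B + ext_norm 2 A * ext_norm 2 B"
    unfolding cauchy_binet_minor
    by (intro order_trans[OF abs_triangle_ineq] add_mono)
      (auto simp: abs_mult intro!: mult_mono minor_le_ext_norm_2 ext_norm_2_nonneg)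
  then show "\<bar>(A ** B) $ i $ k * (A ** B) $ j $ l - (A ** B) $ i $ l * (A ** B) $ j $ k\<bar>
      \<le> 3 * ext_norm 2 A * ext_norm 2 B"
    by simp
qed

lemma ext_norm_2_le: "ext_norm 2 A \<le> 2 * (ext_norm 1 (A :: real^3^3))\<^sup>2"
proof (rule ext_norm_2_leI)
  fix i j k l :: 3
  have "\<bar>A $ i $ k * A $ j $ l - A $ i $ l * A $ j $ k\<bar>
      \<le> \<bar>A $ i $ k\<bar> * \<bar>A $ j $ l\<bar> + \<bar>A $ i $ l\<bar> * \<bar>A $ j $ k\<bar>"
    by (rule order_trans[OF abs_triangle_ineq4]) (simp add: abs_mult)
  also have "\<dots> \<le> ext_norm 1 A * ext_norm 1 A + ext_norm 1 A * ext_norm 1 A"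
    by (intro add_mono mult_mono abs_entry_le_ext_norm_1 ext_norm_1_nonneg abs_ge_zero)
  finally show "\<bar>A $ i $ k * A $ j $ l - A $ i $ l * A $ j $ k\<bar> \<le> 2 * (ext_norm 1 A)\<^sup>2"
    by (simp add: power2_eq_square)
qed

text \<open>Indices are taken modulo 3.\<close>

definition cofactor_matrix :: "real^3^3 \<Rightarrow> real^3^3" where
  "cofactor_matrix A = (\<chi> i j. A $ (i + 1) $ (j + 1) * A $ (i + 2) $ (j + 2)
     - A $ (i + 1) $ (j + 2) * A $ (i + 2) $ (j + 1))"

text \<open>For invertible \<open>A\<close> the cofactor matrix is \<open>det A\<close> times the
  inverse transpose, and its determinant is the square of \<open>det A\<close>. Being polynomial,
  the identity extends to singular \<open>A\<close>. Cyclic indices absorb the usual signs.\<close>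

lemma cofactor_matrix_involution:
  "cofactor_matrix (cofactor_matrix A) $ i $ j = det A * A $ i $ j"
proof -
  have add3: "(1::3) + 1 = 2" "(1::3) + 2 = 3" "(2::3) + 1 = 3" "(2::3) + 2 = 1" "(3::3) + 1 = 1" "(3::3) + 2 = 2"
    by simp_all
  have "\<forall>i j. cofactor_matrix (cofactor_matrix A) $ i $ j = det A * A $ i $ j"
    unfolding forall_3 cofactor_matrix_def vec_lambda_beta add3 det_3
    by (intro conjI; algebra)
  then show ?thesis by blast
qed

text \<open>Up to sign \<open>A\<close> is the cofactor matrix of its cofactor matrix, so its
  entries are quadratic in its own minors. This later orders the last two exponents.\<close>

lemma ext_norm_1_le_ext_norm_2:
  assumes "\<bar>det A\<bar> = 1"
  shows "ext_norm 1 A \<le> 2 * (ext_norm 2 (A :: real^3^3))\<^sup>2"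
proof (rule ext_norm_1_leI)
  fix i j
  define C where "C = cofactor_matrix A"
  have C: "\<bar>C $ i $ j\<bar> \<le> ext_norm 2 A" for i j
    unfolding C_def cofactor_matrix_def vec_lambda_beta by (rule minor_le_ext_norm_2)
  have "\<bar>A $ i $ j\<bar> = \<bar>cofactor_matrix C $ i $ j\<bar>"
    using assms by (simp add: C_def cofactor_matrix_involution abs_mult)
  also have "\<dots> \<le> \<bar>C $ (i + 1) $ (j + 1)\<bar> * \<bar>C $ (i + 2) $ (j + 2)\<bar> + \<bar>C $ (i + 1) $ (j + 2)\<bar> * \<bar>C $ (i + 2) $ (j + 1)\<bar>"
    unfolding cofactor_matrix_def vec_lambda_beta
    by (rule order_trans[OF abs_triangle_ineq4]) (simp add: abs_mult)
  also have "\<dots> \<le> ext_norm 2 A * ext_norm 2 A + ext_norm 2 A * ext_norm 2 A"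
    by (intro add_mono mult_mono C ext_norm_2_nonneg abs_ge_zero)
  finally show "\<bar>A $ i $ j\<bar> \<le> 2 * (ext_norm 2 A)\<^sup>2"
    by (simp add: power2_eq_square)
qed

section \<open>Words\<close>

text \<open>The free tail \<open>z\<close> allows statements about prefixes common to all
  continuations. Here \<open>n\<close> counts substitutions, whereas
  \<open>approx_word \<gamma> n\<close> applies \<open>Suc n\<close> of them.\<close>

definition subst_word :: "nat \<Rightarrow> 2 stream \<Rightarrow> 3 stream \<Rightarrow> 3 stream" where
  "subst_word n \<gamma> z = foldr (\<lambda>i. apply_subst (csubst i)) (stake n \<gamma>) z"

definition subst_list :: "nat \<Rightarrow> 2 stream \<Rightarrow> 3 list \<Rightarrow> 3 list" where
  "subst_list n \<gamma> u = foldr (\<lambda>i u. concat (map (csubst i) u)) (stake n \<gamma>) u"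

lemma approx_word_eq: "approx_word \<gamma> n = subst_word (Suc n) \<gamma> (sconst 1)"
  by (simp add: approx_word_def subst_word_def)

lemma subst_word_0: "subst_word 0 \<gamma> z = z"
  by (simp add: subst_word_def)

lemma subst_word_Suc: "subst_word (Suc n) \<gamma> z = apply_subst (csubst (shd \<gamma>)) (subst_word n (stl \<gamma>) z)"
  by (simp add: subst_word_def)

lemma subst_word_add: "subst_word (m + n) \<gamma> z = subst_word m \<gamma> (subst_word n (sdrop m \<gamma>) z)"
  by (induction m arbitrary: \<gamma>) (simp_all add: subst_word_0 subst_word_Suc)

lemma apply_subst_Stream: "apply_subst (csubst i) (a ## y) = csubst i a @- apply_subst (csubst i) y"
  by (simp add: apply_subst_def csubst_nonempty)

lemma apply_subst_shift:
  "apply_subst (csubst i) (u @- y) = concat (map (csubst i) u) @- apply_subst (csubst i) y"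
  by (induction u) (simp_all add: apply_subst_Stream)

lemma subst_word_shift: "subst_word n \<gamma> (u @- z) = subst_list n \<gamma> u @- subst_word n \<gamma> z"
  by (induction n arbitrary: \<gamma>) (simp_all add: subst_word_def subst_list_def apply_subst_shift)

section \<open>Common prefixes and convergence of the approximating words\<close>

lemma length_subst_letters: "length u \<le> length (concat (map (csubst i) u))"
proof (induction u)
  case (Cons a u)
  then show ?case
    using csubst_nonempty[of i a] by (cases "csubst i a") auto
qed simp

lemma length_subst_list: "length u \<le> length (subst_list n \<gamma> u)"
  by (induction n arbitrary: \<gamma>) (auto simp: subst_list_def intro: order_trans[OF _ length_subst_letters])

text \<open>Under \<open>c1\<close>, \<open>c2\<close>, \<open>c1\<close>, \<open>c2\<close>, the
  last acting first, the letters 1, 2, 3 become 132, 1312 and 12.\<close>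

lemma block_subst_list:
  assumes "block \<gamma>"
  shows "2 * length u \<le> length (subst_list 4 \<gamma> u)" "u \<noteq> [] \<Longrightarrow> hd (subst_list 4 \<gamma> u) = 1"
proof -
  have stake4: "stake 4 \<gamma> = [1, 2, 1, 2]"
    using assms by (simp add: block_def cylinder_def numeral_eq_Suc)
  have split: "subst_list 4 \<gamma> (a # u) = subst_list 4 \<gamma> [a] @ subst_list 4 \<gamma> u" for a u
    by (simp add: subst_list_def stake4)
  have "\<forall>a. 2 \<le> length (subst_list 4 \<gamma> [a]) \<and> hd (subst_list 4 \<gamma> [a]) = 1"
    unfolding forall_3 by (simp add: subst_list_def stake4 csubst_def c1_def c2_def)
  then have letter: "2 \<le> length (subst_list 4 \<gamma> [a])" "hd (subst_list 4 \<gamma> [a]) = 1" for a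
    by blast+
  show "2 * length u \<le> length (subst_list 4 \<gamma> u)"
  proof (induction u)
    case (Cons a u)
    then show ?case
      using letter(1)[of a] by (simp add: split[of a u])
  qed simp
  show "hd (subst_list 4 \<gamma> u) = 1" if nonempty: "u \<noteq> []"
  proof -
    obtain a u' where u: "u = a # u'"
      using nonempty by (cases u) auto
    have "subst_list 4 \<gamma> [a] \<noteq> []"
      using letter(1)[of a] by auto
    then show ?thesis
      using letter(2)[of a] by (simp add: u split[of a u'])
  qed
qed

text \<open>The four substitutions of a block make every continuation start with 1. Applied to a
  common prefix produced by a later block, they at least double its length; induction over
  successive blocks gives any length.\<close>

lemma long_common_prefix_at_block:
  assumes inf: "\<And>N. \<exists>m\<ge>N. block (sdrop m \<gamma>)" and "block \<gamma>"
  shows "\<exists>n u. length u > l \<and> hd u = 1 \<and> (\<forall>z. \<exists>z'. subst_word n \<gamma> z = u @- z')"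
  using assms
proof (induction l arbitrary: \<gamma>)
  case 0
  have "subst_word 4 \<gamma> z = [1] @- stl (subst_word 4 \<gamma> z)" for z
  proof -
    define u where "u = subst_list 4 \<gamma> [shd z]"
    have u: "u \<noteq> []" "hd u = 1"
      using block_subst_list[OF 0(2), of "[shd z]"] by (auto simp: u_def)
    have "subst_word 4 \<gamma> z = u @- subst_word 4 \<gamma> (stl z)"
      using subst_word_shift[of 4 \<gamma> "[shd z]" "stl z"] by (simp add: u_def)
    then have "shd (subst_word 4 \<gamma> z) = 1"
      using u by simp
    then show ?thesis
      by (metis shift.simps stream.collapse)
  qed
  then show ?case
    by (intro exI[of _ 4] exI[of _ "[1]"]) (auto intro: exI)
next
  case (Suc l)
  \<comment> \<open>With \<open>m \<ge> 4\<close> the later block begins after the four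
    substitutions that do the doubling here.\<close>
  obtain m where m: "m \<ge> 4" "block (sdrop m \<gamma>)"
    using Suc.prems(1) by blast
  have "\<exists>k\<ge>N. block (sdrop k (sdrop m \<gamma>))" for N
  proof -
    obtain k where "k \<ge> N + m" "block (sdrop k \<gamma>)"
      using Suc.prems(1) by blast
    then show ?thesis
      by (intro exI[of _ "k - m"]) auto
  qed
  then obtain n u where u: "length u > l" "hd u = 1"
    and pre: "\<And>z. \<exists>z'. subst_word n (sdrop m \<gamma>) z = u @- z'"
    using Suc.IH[OF _ m(2)] by blast
  define v where "v = subst_list (m - 4) (sdrop 4 \<gamma>) u"
  have v: "length v > l"
    using u(1) length_subst_list[of u] unfolding v_def by (rule less_le_trans)
  have "\<exists>z'. subst_word (m + n) \<gamma> z = subst_list 4 \<gamma> v @- z'" for z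
  proof -
    obtain z' where z': "subst_word n (sdrop m \<gamma>) z = u @- z'"
      using pre by blast
    have "subst_word (m + n) \<gamma> z = subst_word (4 + (m - 4)) \<gamma> (u @- z')"
      using m(1) by (simp add: subst_word_add z')
    also have "\<dots> = subst_word 4 \<gamma> (subst_word (m - 4) (sdrop 4 \<gamma>) (u @- z'))"
      by (rule subst_word_add)
    also have "\<dots> = subst_list 4 \<gamma> v @- subst_word 4 \<gamma> (subst_word (m - 4) (sdrop 4 \<gamma>) z')"
      by (simp only: subst_word_shift v_def)
    finally show ?thesis by blast
  qed
  moreover have "length (subst_list 4 \<gamma> v) > Suc l"
    using block_subst_list(1)[OF Suc.prems(2), of v] v by simp
  moreover have "hd (subst_list 4 \<gamma> v) = 1"
    using v by (intro block_subst_list(2)[OF Suc.prems(2)]) auto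
  ultimately show ?case by blast
qed

lemma long_common_prefix:
  assumes inf: "\<And>N. \<exists>m\<ge>N. block (sdrop m \<gamma>)"
  obtains n u where "length u \<ge> l" "\<And>z. \<exists>z'. subst_word n \<gamma> z = u @- z'"
proof -
  obtain m where m: "block (sdrop m \<gamma>)"
    using inf by blast
  have "\<exists>k\<ge>N. block (sdrop k (sdrop m \<gamma>))" for N
  proof -
    obtain k where "k \<ge> N + m" "block (sdrop k \<gamma>)"
      using inf by blast
    then show ?thesis
      by (intro exI[of _ "k - m"]) auto
  qed
  from long_common_prefix_at_block[OF this m, of l]
  obtain n u where u: "length u > l" and pre: "\<And>z. \<exists>z'. subst_word n (sdrop m \<gamma>) z = u @- z'"
    by blast
  have "length (subst_list m \<gamma> u) \<ge> l"
    using u length_subst_list[of u m \<gamma>] by simp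
  moreover have "\<exists>z'. subst_word (m + n) \<gamma> z = subst_list m \<gamma> u @- z'" for z
    using pre[of z] by (auto simp: subst_word_add subst_word_shift)
  ultimately show thesis by (rule that)
qed

lemma word_tendstoI:
  assumes "\<And>k. \<exists>a. \<forall>\<^sub>F n in sequentially. W n !! k = a"
  obtains w where "word_tendsto W w"
proof -
  obtain c where c: "\<And>k. \<forall>\<^sub>F n in sequentially. W n !! k = c k"
    using assms by metis
  have "\<forall>\<^sub>F n in sequentially. stake k (W n) = stake k (smap c nats)" for k
  proof -
    have "\<forall>\<^sub>F n in sequentially. \<forall>i\<in>{..<k}. W n !! i = c i"
      by (rule eventually_ball_finite) (auto intro: c)
    then show ?thesis
      by eventually_elim (auto intro!: nth_equalityI)
  qed
  then have "word_tendsto W (smap c nats)"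
    by (simp add: word_tendsto_def)
  then show thesis by (rule that)
qed

lemma approx_word_converges:
  assumes inf: "\<And>N. \<exists>m\<ge>N. block (sdrop m \<gamma>)"
  obtains w where "word_tendsto (approx_word \<gamma>) w"
proof (rule word_tendstoI)
  fix k
  obtain n u where u: "length u \<ge> Suc k" and pre: "\<And>z. \<exists>z'. subst_word n \<gamma> z = u @- z'"
    by (rule long_common_prefix[OF inf, where l = "Suc k"]) (rule that)
  have "approx_word \<gamma> N !! k = u ! k" if "N \<ge> n" for N
  proof -
    have "approx_word \<gamma> N = subst_word n \<gamma> (subst_word (Suc N - n) (sdrop n \<gamma>) (sconst 1))"
      using subst_word_add[of n "Suc N - n" \<gamma> "sconst 1"] that by (simp add: approx_word_eq)
    then obtain z' where "approx_word \<gamma> N = u @- z'"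
      using pre by metis
    then show ?thesis
      using u by simp
  qed
  then show "\<exists>a. \<forall>\<^sub>F N in sequentially. approx_word \<gamma> N !! k = a"
    unfolding eventually_sequentially by blast
qed (rule that)

section \<open>Letter counts of prefixes and balancedness\<close>

definition weight :: "real^3 \<Rightarrow> 3 list \<Rightarrow> real" where
  "weight v u = sum_list (map (\<lambda>a. v $ a) u)"

lemma weight_simps [simp]:
  "weight v [] = 0" "weight v (a # u) = v $ a + weight v u" "weight v (u @ u') = weight v u + weight v u'"
  by (simp_all add: weight_def)

text \<open>The duality behind the method: substituting in the word amounts to moving the form one
  step along the cocycle.\<close>

lemma weight_csubst: "weight v (csubst i a) = (v v* cmatrix i) $ a"
proof -
  have "\<forall>a. weight v (csubst i a) = (v v* cmatrix i) $ a"
    using index_cases[of i]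
    by (auto simp: forall_3 vector_cmatrix_1 vector_cmatrix_2 csubst_def c1_def c2_def)
  then show ?thesis by blast
qed

lemma weight_subst_letters: "weight v (concat (map (csubst i) u)) = weight (v v* cmatrix i) u"
  by (induction u) (simp_all add: weight_csubst)

lemma abs_weight_le:
  assumes "\<And>a. \<bar>v $ a\<bar> \<le> B"
  shows "\<bar>weight v u\<bar> \<le> real (length u) * B"
proof (induction u)
  case (Cons a u)
  have "\<bar>weight v (a # u)\<bar> \<le> \<bar>v $ a\<bar> + \<bar>weight v u\<bar>"
    by simp
  also have "\<dots> \<le> B + real (length u) * B"
    by (intro add_mono assms Cons)
  finally show ?case
    by (simp add: algebra_simps)
qed simp

text \<open>\<open>j\<close> counts the letter images lying completely before the cut, at most
  \<open>k\<close> because images are nonempty; \<open>s\<close> is the cut piece of the next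
  image.\<close>

lemma stake_apply_subst:
  "\<exists>j s. j \<le> k \<and> s \<in> {[], [1]} \<and>
    stake k (apply_subst (csubst i) y) = concat (map (csubst i) (stake j y)) @ s"
proof (induction k arbitrary: y rule: less_induct)
  case (less k)
  define u where "u = csubst i (shd y)"
  have y: "apply_subst (csubst i) y = u @- apply_subst (csubst i) (stl y)"
    using apply_subst_Stream[of i "shd y" "stl y"] by (simp add: u_def)
  have "u \<noteq> []"
    by (simp add: u_def csubst_nonempty)
  show ?case
  proof (cases "k < length u")
    case True
    have "\<forall>a. k < length (csubst i a) \<longrightarrow> take k (csubst i a) \<in> {[], [1]}"
      using index_cases[of i]
      by (auto simp: forall_3 csubst_def c1_def c2_def less_Suc_eq take_Cons')
    then have "take k u \<in> {[], [1]}"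
      using True unfolding u_def by blast
    then show ?thesis
      using True by (intro exI[of _ 0] exI[of _ "take k u"]) (simp add: y stake_shift)
  next
    case False
    have "k - length u < k"
      using False \<open>u \<noteq> []\<close> by (cases u) auto
    from less.IH[OF this, of "stl y"] obtain j s where j: "j \<le> k - length u" and s: "s \<in> {[], [1]}"
      and eq: "stake (k - length u) (apply_subst (csubst i) (stl y)) = concat (map (csubst i) (stake j (stl y))) @ s"
      by blast
    have "stake k (apply_subst (csubst i) y) = concat (map (csubst i) (stake (Suc j) y)) @ s"
      using False by (simp add: y stake_shift eq) (simp add: u_def)
    moreover have "Suc j \<le> k"
      using j False \<open>u \<noteq> []\<close> by (cases u) auto
    ultimately show ?thesis
      using s by blast
  qed
qed

text \<open>The prefix decomposition of Dumont and Thomas; proper prefixes of the \<open>c\<^sub>i(a)\<close> are empty or \<open>1\<close>.\<close>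

lemma weight_prefix_subst_word:
  assumes "\<And>a. \<bar>(v v* cocycle n \<gamma>) $ a\<bar> \<le> B"
  shows "\<bar>weight v (stake k (subst_word n \<gamma> z))\<bar> \<le> (\<Sum>m<n. \<bar>(v v* cocycle m \<gamma>) $ 1\<bar>) + real k * B"
  using assms
proof (induction n arbitrary: v \<gamma> k)
  case 0
  then show ?case
    using abs_weight_le[of v B "stake k z"] by (simp add: subst_word_0 cocycle_0)
next
  case (Suc n)
  define u where "u = v v* cmatrix (shd \<gamma>)"
  have shift: "u v* cocycle m (stl \<gamma>) = v v* cocycle (Suc m) \<gamma>" for m
    by (simp add: u_def cocycle_Suc_shift vector_matrix_mul_assoc)
  have B: "0 \<le> B"
    using Suc.prems[of 1] by (rule order_trans[OF abs_ge_zero])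
  define y where "y = subst_word n (stl \<gamma>) z"
  obtain j s where j: "j \<le> k" and s: "s \<in> {[], [1]}"
    and eq: "stake k (apply_subst (csubst (shd \<gamma>)) y) = concat (map (csubst (shd \<gamma>)) (stake j y)) @ s"
    using stake_apply_subst by blast
  have "weight v (stake k (subst_word (Suc n) \<gamma> z)) = weight u (stake j y) + weight v s"
    by (simp add: subst_word_Suc eq weight_subst_letters u_def flip: y_def)
  moreover have "\<bar>weight v s\<bar> \<le> \<bar>v $ 1\<bar>"
    using s by auto
  moreover have "\<bar>weight u (stake j y)\<bar> \<le> (\<Sum>m<n. \<bar>(u v* cocycle m (stl \<gamma>)) $ 1\<bar>) + real j * B"
    unfolding y_def by (rule Suc.IH) (simp add: shift Suc.prems)
  moreover have "real j * B \<le> real k * B"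
    using j B by (intro mult_right_mono) auto
  moreover have "(\<Sum>m<Suc n. \<bar>(v v* cocycle m \<gamma>) $ 1\<bar>) = \<bar>v $ 1\<bar> + (\<Sum>m<n. \<bar>(u v* cocycle m (stl \<gamma>)) $ 1\<bar>)"
    by (simp add: sum.lessThan_Suc_shift shift cocycle_0 del: sum.lessThan_Suc)
  ultimately show ?case
    by linarith
qed

text \<open>The prefix decomposition yields a geometric sum and a remainder proportional to
  \<open>k\<close>. Since \<open>n\<close> may be chosen after \<open>k\<close>, the remainder drops
  below 1 and the bound does not depend on \<open>k\<close>.\<close>

lemma weight_prefix_bounded:
  assumes lim: "word_tendsto (approx_word \<gamma>) w"
    and decay: "\<And>n a. \<bar>(v v* cocycle n \<gamma>) $ a\<bar> \<le> K * r ^ n" and r: "0 < r" "r < 1"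
  shows "\<bar>weight v (stake k w)\<bar> \<le> K / (1 - r) + 1"
proof -
  have K: "0 \<le> K"
    using decay[of 0 1] by (simp add: cocycle_0)
  have "(\<lambda>n. real k * (K * r ^ Suc n)) \<longlonglongrightarrow> real k * (K * 0)"
    using r by (intro tendsto_intros LIMSEQ_Suc[OF LIMSEQ_realpow_zero]) auto
  then have "\<forall>\<^sub>F n in sequentially. real k * (K * r ^ Suc n) < 1"
    by (rule order_tendstoD) simp
  moreover have "\<forall>\<^sub>F n in sequentially. stake k (approx_word \<gamma> n) = stake k w"
    using lim by (simp add: word_tendsto_def)
  ultimately have "\<forall>\<^sub>F n in sequentially. \<bar>weight v (stake k w)\<bar> \<le> K / (1 - r) + 1"
  proof eventually_elim
    case (elim n)
    have "\<bar>weight v (stake k w)\<bar> \<le> (\<Sum>m<Suc n. \<bar>(v v* cocycle m \<gamma>) $ 1\<bar>) + real k * (K * r ^ Suc n)"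
      unfolding elim(2)[symmetric] approx_word_eq by (rule weight_prefix_subst_word[OF decay])
    also have "(\<Sum>m<Suc n. \<bar>(v v* cocycle m \<gamma>) $ 1\<bar>) \<le> (\<Sum>m<Suc n. K * r ^ m)"
      by (intro sum_mono decay)
    also have "\<dots> = K * ((1 - r ^ Suc n) / (1 - r))"
      using r by (subst sum_distrib_left[symmetric], subst sum_gp_strict) auto
    also have "\<dots> \<le> K / (1 - r)"
      using r K by (simp add: divide_right_mono mult_left_le)
    finally show ?case
      using elim(1) by linarith
  qed
  then show ?thesis
    by simp
qed

lemma weight_frequency:
  fixes f :: "real^3"
  shows "weight (axis a 1 - f $ a *\<^sub>R vec 1) u = real (count_list u a) - f $ a * real (length u)"
  by (induction u) (auto simp: axis_def algebra_simps)

lemma balancedI: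
  fixes f :: "real^3"
  assumes "\<And>a k. \<bar>weight (axis a 1 - f $ a *\<^sub>R vec 1) (stake k w)\<bar> \<le> B a"
  shows "balanced w"
proof -
  \<comment> \<open>Two factors are compared and each is a difference of two prefixes, whence 4; the
    summand 1 makes \<open>K\<close> positive.\<close>
  define K where "K = 4 * (\<Sum>a\<in>UNIV. B a) + 1"
  have B: "0 \<le> B a" for a
    using assms[of a 0] by simp
  have dev: "\<bar>real (count_list u a) - f $ a * real (length u)\<bar> \<le> 2 * B a" if fac: "factor u w" for u a
  proof -
    obtain m n where u: "u = stake n (sdrop m w)"
      using fac unfolding factor_def by blast
    define v :: "real^3" where "v = axis a 1 - f $ a *\<^sub>R vec 1"
    have "weight v u = weight v (stake (m + n) w) - weight v (stake m w)"
      unfolding u by (simp flip: stake_add)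
    moreover have "weight v u = real (count_list u a) - f $ a * real (length u)"
      unfolding v_def by (rule weight_frequency)
    ultimately show ?thesis
      using assms[of a "m + n"] assms[of a m] unfolding v_def[symmetric] by linarith
  qed
  have "\<bar>real (count_list u a) - real (count_list v a)\<bar> \<le> K"
    if "factor u w" "factor v w" "length u = length v" for u v a
  proof -
    have "B a \<le> (\<Sum>a\<in>UNIV. B a)"
      by (rule member_le_sum) (auto simp: B)
    then show ?thesis
      using dev[OF that(1), of a] dev[OF that(2), of a] that(3) unfolding K_def by simp
  qed
  moreover have "K > 0"
    using sum_nonneg[of UNIV B] B by (simp add: K_def)
  ultimately show ?thesis
    unfolding balanced_def by blast
qed

section \<open>The directive sequences in which blocks are frequent\<close>

lemma vector_deviation:
  "((axis a 1 - f $ a *\<^sub>R vec 1) v* A) $ j = A $ a $ j - f $ a * (vec 1 v* (A :: real^3^3)) $ j"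
proof -
  have "\<forall>a. ((axis a 1 - f $ a *\<^sub>R vec 1) v* A) $ j = A $ a $ j - f $ a * (vec 1 v* A) $ j"
    unfolding forall_3 by (simp add: vector_matrix_mult_def sum_3 axis_def algebra_simps)
  then show ?thesis by blast
qed

lemma deviation_decay:
  assumes freq: "frequent_blocks p \<gamma>" and p: "0 < p"
  obtains f :: "real^3" and K where "\<And>a. 0 \<le> f $ a" "\<And>a. f $ a \<le> 1"
    "\<And>n a j. \<bar>((axis a 1 - f $ a *\<^sub>R vec 1) v* cocycle n \<gamma>) $ j\<bar> \<le> K * decay_rate p ^ n"
proof -
  obtain f :: "real^3" where f: "\<And>a. 0 \<le> f $ a" "\<And>a. f $ a \<le> 1" and f_sum: "(\<Sum>a\<in>UNIV. f $ a) = 1"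
    and mixed: "\<And>v n. v \<bullet> f = 0 \<Longrightarrow> mixed_sign (v v* cocycle n \<gamma>)"
    by (rule frequency_vector) (rule that)
  define v :: "3 \<Rightarrow> real^3" where "v a = axis a 1 - f $ a *\<^sub>R vec 1" for a
  have "vec 1 \<bullet> f = 1"
    using f_sum by (simp add: inner_vec_def)
  \<comment> \<open>The form measuring how far the count of \<open>a\<close> deviates from its
    expected value vanishes at \<open>f\<close>, because the coordinates of \<open>f\<close> sum to
    1.\<close>
  then have "v a \<bullet> f = 0" for a
    by (simp add: v_def inner_diff_left inner_axis')
  then have mixed': "mixed_sign (v a v* cocycle n \<gamma>)" for a n
    by (rule mixed)
  have "\<exists>K\<ge>0. \<forall>n. spread (v a v* cocycle n \<gamma>) \<le> K * decay_rate p ^ n" for a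
    using spread_decay[OF freq mixed' p] by metis
  then obtain K where K: "\<And>a. K a \<ge> 0" "\<And>a n. spread (v a v* cocycle n \<gamma>) \<le> K a * decay_rate p ^ n"
    by metis
  have "\<bar>(v a v* cocycle n \<gamma>) $ j\<bar> \<le> (\<Sum>a\<in>UNIV. K a) * decay_rate p ^ n" for a n j
  proof -
    have "\<bar>(v a v* cocycle n \<gamma>) $ j\<bar> \<le> K a * decay_rate p ^ n"
      using abs_le_spread[OF mixed'] K(2) by (rule order_trans)
    also have "\<dots> \<le> (\<Sum>a\<in>UNIV. K a) * decay_rate p ^ n"
      using decay_rate_bounds(1)[of p] by (intro mult_right_mono member_le_sum) (auto simp: K)
    finally show ?thesis .
  qed
  with f show thesis
    unfolding v_def by (rule that)
qed

text \<open>All columns of \<open>A\<close> are close to multiples of \<open>f\<close>, so that the two-by-two minors are small.\<close>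

lemma ext_norm_2_near_rank_one:
  fixes A :: "real^3^3" and f :: "real^3"
  assumes f: "\<And>a. 0 \<le> f $ a" "\<And>a. f $ a \<le> 1"
    and e: "\<And>a j. \<bar>((axis a 1 - f $ a *\<^sub>R vec 1) v* A) $ j\<bar> \<le> e"
  shows "ext_norm 2 A \<le> 8 * e * ext_norm 1 A"
proof (rule ext_norm_2_leI)
  fix i j k l :: 3
  define m where "m = ext_norm 1 A"
  define s where "s = vec 1 v* A"
  define R where "R a b = A $ a $ b - f $ a * s $ b" for a b
  have R: "\<bar>R a b\<bar> \<le> e" for a b
    using e[of a b] unfolding vector_deviation R_def s_def .
  have A: "\<bar>A $ a $ b\<bar> \<le> m" for a b
    unfolding m_def by (rule abs_entry_le_ext_norm_1)
  have m: "0 \<le> m" and e0: "0 \<le> e"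
    using A[of 1 1] R[of 1 1] by linarith+
  have s: "\<bar>s $ b\<bar> \<le> 3 * m" for b
    using A[of 1 b] A[of 2 b] A[of 3 b] by (simp add: s_def vector_matrix_mult_def sum_3)
  have fs: "\<bar>f $ a * s $ b\<bar> \<le> 3 * m" for a b
  proof -
    have "\<bar>f $ a * s $ b\<bar> \<le> 1 * (3 * m)"
      unfolding abs_mult using f[of a] s[of b] by (intro mult_mono) auto
    then show ?thesis by simp
  qed
  \<comment> \<open>Splitting \<open>A\<close> into the rank-one part and \<open>R\<close>, the
    products of two rank-one entries cancel. Each remaining term has a factor \<open>R\<close>, the
    other factor being at most \<open>m\<close> or \<open>3 * m\<close>; each occurs twice, whence
    8.\<close>
  have "A $ i $ k * A $ j $ l - A $ i $ l * A $ j $ k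
      = A $ i $ k * R j l + R i k * (f $ j * s $ l) - (A $ i $ l * R j k + R i l * (f $ j * s $ k))"
    by (simp add: R_def algebra_simps)
  also have "\<bar>\<dots>\<bar> \<le> (m * e + e * (3 * m)) + (m * e + e * (3 * m))"
    by (intro order_trans[OF abs_triangle_ineq4] order_trans[OF abs_triangle_ineq] add_mono;
        unfold abs_mult[of "A $ _ $ _"] abs_mult[of "R _ _"]; intro mult_mono A R fs m e0 abs_ge_zero)
  finally show "\<bar>A $ i $ k * A $ j $ l - A $ i $ l * A $ j $ k\<bar> \<le> 8 * e * ext_norm 1 A"
    by (simp add: m_def algebra_simps)
qed

lemma ext_norm_2_cocycle_le:
  assumes "frequent_blocks p \<gamma>" "0 < p"
  obtains K where "\<And>n. ext_norm 2 (cocycle n \<gamma>) \<le> K * decay_rate p ^ n * ext_norm 1 (cocycle n \<gamma>)"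
proof -
  obtain f :: "real^3" and K where f: "\<And>a. 0 \<le> f $ a" "\<And>a. f $ a \<le> 1"
    and K: "\<And>n a j. \<bar>((axis a 1 - f $ a *\<^sub>R vec 1) v* cocycle n \<gamma>) $ j\<bar> \<le> K * decay_rate p ^ n"
    by (rule deviation_decay[OF assms]) (rule that)
  have "ext_norm 2 (cocycle n \<gamma>) \<le> (8 * K) * decay_rate p ^ n * ext_norm 1 (cocycle n \<gamma>)" for n
    using ext_norm_2_near_rank_one[OF f K] by (simp add: mult.assoc)
  then show thesis by (rule that)
qed

lemma limit_word_balanced:
  assumes "frequent_blocks p \<gamma>" "0 < p"
  shows "\<exists>w. word_tendsto (approx_word \<gamma>) w \<and> balanced w"
proof -
  have "\<exists>m\<ge>N. block (sdrop m \<gamma>)" for N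
    using frequent_blocks_infinitely_often[OF assms] by metis
  then obtain w where w: "word_tendsto (approx_word \<gamma>) w"
    by (rule approx_word_converges)
  obtain f :: "real^3" and K where "\<And>a. 0 \<le> f $ a" "\<And>a. f $ a \<le> 1" and
    K: "\<And>n a j. \<bar>((axis a 1 - f $ a *\<^sub>R vec 1) v* cocycle n \<gamma>) $ j\<bar> \<le> K * decay_rate p ^ n"
    by (rule deviation_decay[OF assms]) (rule that)
  have "\<bar>weight (axis a 1 - f $ a *\<^sub>R vec 1) (stake k w)\<bar> \<le> K / (1 - decay_rate p) + 1" for a k
    using decay_rate_bounds[of p] assms(2) by (intro weight_prefix_bounded[OF w K]) auto
  then have "balanced w"
    by (rule balancedI)
  with w show ?thesis by blast
qed

section \<open>Lyapunov exponents\<close>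

lemma ext_norm_1_cocycle_ge: "1 \<le> 3 * ext_norm 1 (cocycle n \<gamma>)"
proof -
  have "1 \<le> (vec 1 v* cocycle n \<gamma>) $ 1"
    by (rule column_sum_ge_1)
  also have "\<dots> = cocycle n \<gamma> $ 1 $ 1 + cocycle n \<gamma> $ 2 $ 1 + cocycle n \<gamma> $ 3 $ 1"
    by (simp add: vector_matrix_mult_def sum_3)
  also have "\<dots> \<le> 3 * ext_norm 1 (cocycle n \<gamma>)"
    using abs_entry_le_ext_norm_1[of "cocycle n \<gamma>" 1 1] abs_entry_le_ext_norm_1[of "cocycle n \<gamma>" 2 1]
      abs_entry_le_ext_norm_1[of "cocycle n \<gamma>" 3 1] by linarith
  finally show ?thesis .
qed

lemma det_cocycle: "\<bar>det (cocycle n \<gamma>)\<bar> = 1"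
proof (induction n arbitrary: \<gamma>)
  case 0
  then show ?case by (simp add: cocycle_0)
next
  case (Suc n)
  have "\<bar>det (cmatrix i)\<bar> = 1" for i
    by (simp add: cmatrix_def C1_def C2_def det_3)
  then show ?case
    by (simp add: cocycle_Suc_shift det_mul abs_mult Suc)
qed

text \<open>A value below 1/3 would, by \<open>ext_norm_1_le_ext_norm_2\<close>, push the first norm
  below 2/9, against \<open>ext_norm_1_cocycle_ge\<close>.\<close>

lemma ext_norm_2_cocycle_ge: "1 \<le> 3 * ext_norm 2 (cocycle n \<gamma>)"
proof (rule ccontr)
  define x where "x = ext_norm 2 (cocycle n \<gamma>)"
  assume "\<not> 1 \<le> 3 * ext_norm 2 (cocycle n \<gamma>)"
  then have x: "x < 1/3" "0 \<le> x"
    by (simp_all add: x_def ext_norm_2_nonneg)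
  have "1/3 \<le> 2 * x\<^sup>2"
    using ext_norm_1_cocycle_ge[of n \<gamma>] ext_norm_1_le_ext_norm_2[OF det_cocycle, of n \<gamma>]
    by (simp add: x_def)
  moreover have "x * x \<le> 1/3 * (1/3)"
    using x by (intro mult_mono) auto
  ultimately show False
    by (simp add: power2_eq_square)
qed

lemma ext_norm_1_cmatrix: "ext_norm 1 (cmatrix i) \<le> 1"
proof (rule ext_norm_1_leI)
  have "\<forall>a b. \<bar>cmatrix i $ a $ b\<bar> \<le> 1"
    by (simp add: forall_3 cmatrix_def C1_def C2_def)
  then show "\<bar>cmatrix i $ a $ b\<bar> \<le> 1" for a b
    by blast
qed

lemma ext_norm_2_cmatrix: "ext_norm 2 (cmatrix i) \<le> 2"
proof -
  have "(ext_norm 1 (cmatrix i))\<^sup>2 \<le> 1"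
    using ext_norm_1_cmatrix[of i] ext_norm_1_nonneg[of "cmatrix i"] by (simp add: power_le_one)
  then show ?thesis
    using ext_norm_2_le[of "cmatrix i"] by simp
qed

section \<open>The shift as an ergodic system and the existence of growth exponents\<close>

lemma sdrop_eq_funpow: "sdrop n s = (stl ^^ n) s"
  by (induction n arbitrary: s) (simp_all add: funpow_swap1)

lemma ergodic_system_stl:
  assumes "ergodic_shift_measure \<mu>"
  shows "ergodic_system \<mu> stl" "space \<mu> = UNIV"
proof -
  have sets: "sets \<mu> = sets (stream_space (count_space UNIV))"
    using assms by (simp add: ergodic_shift_measure_def)
  from sets_eq_imp_space_eq[OF sets] show space: "space \<mu> = UNIV"
    by (simp add: space_stream_space)
  have "stl \<in> measurable \<mu> \<mu>"
    unfolding measurable_cong_sets[OF sets sets] using measurable_stl by simp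
  then show "ergodic_system \<mu> stl"
    using assms unfolding ergodic_shift_measure_def ergodic_system_def ergodic_system_axioms_def
    by (auto simp: space)
qed

lemma measurable_stake_shift:
  fixes \<mu> :: "'a::finite stream measure"
  assumes "ergodic_shift_measure \<mu>"
  shows "stake n \<in> measurable \<mu> (count_space UNIV)"
proof -
  have sets: "sets \<mu> = sets (stream_space (count_space UNIV))"
    using assms by (simp add: ergodic_shift_measure_def)
  show ?thesis
    unfolding measurable_cong_sets[OF sets refl] by (rule measurable_stake)
qed

lemma cylinder_measurable:
  fixes \<mu> :: "'a::finite stream measure"
  assumes "ergodic_shift_measure \<mu>"
  shows "cylinder u \<in> sets \<mu>"
proof -
  have "cylinder u = stake (length u) -` {u} \<inter> space \<mu>"
    using ergodic_system_stl(2)[OF assms] by (auto simp: cylinder_def)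
  then show ?thesis
    using measurable_sets[OF measurable_stake_shift[OF assms], of "{u}"] by simp
qed

lemma AE_frequent_blocks:
  assumes erg: "ergodic_shift_measure \<mu>"
    and pos: "measure \<mu> (cylinder [1, 2, 1, 2, 1, 2, 1, 2]) > 0"
  obtains p where "p > 0" "AE \<gamma> in \<mu>. frequent_blocks p \<gamma>"
proof -
  interpret ergodic_system \<mu> stl
    by (rule ergodic_system_stl[OF erg])
  define B where "B = {\<gamma>. block \<gamma>}"
  have B_cyl: "B = cylinder [1, 2, 1, 2, 1, 2, 1, 2]"
    by (auto simp: B_def block_def)
  have B: "B \<in> sets \<mu>"
    unfolding B_cyl by (rule cylinder_measurable[OF erg])
  \<comment> \<open>Half the measure, so that Birkhoff's bound with error \<open>p\<close> still
    leaves the frequency \<open>p\<close>.\<close>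
  define p where "p = prob B / 2"
  have p: "p > 0"
    using pos by (simp add: p_def B_cyl)
  have count: "(\<Sum>i<n. indicator B ((stl ^^ i) \<gamma>)) = real (block_count n \<gamma>)" for n \<gamma>
    by (induction n) (simp_all add: block_count_Suc, simp_all add: block_count_def B_def sdrop_eq_funpow)
  have "AE \<gamma> in \<mu>. \<forall>\<^sub>F n in sequentially. ((\<integral>\<gamma>. indicator B \<gamma> \<partial>\<mu>) - p) * real n
      \<le> (\<Sum>i<n. indicator B ((stl ^^ i) \<gamma>))"
    using B p by (intro birkhoff_lower[where C = 1]) (auto simp: indicator_def)
  moreover have "(\<integral>\<gamma>. indicator B \<gamma> \<partial>\<mu>) - p = p"
    using B by (simp add: p_def)
  ultimately have "AE \<gamma> in \<mu>. frequent_blocks p \<gamma>"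
    by (simp add: frequent_blocks_def count)
  with p show thesis by (rule that)
qed

text \<open>The logarithm of \<open>3 * N\<close> along the cocycle is subadditive by
  \<open>mult\<close>, nonnegative by \<open>lower\<close>, and grows by at most \<open>ln 6\<close>
  per step by \<open>upper\<close>. The factor 3 disappears on division by \<open>n\<close>.\<close>

lemma growth_exponent_exists:
  fixes \<mu> :: "2 stream measure" and N :: "real^3^3 \<Rightarrow> real"
  assumes erg: "ergodic_shift_measure \<mu>"
    and mult: "\<And>A B. N (A ** B) \<le> 3 * N A * N B"
    and lower: "\<And>n \<gamma>. 1 \<le> 3 * N (cocycle n \<gamma>)"
    and upper: "\<And>i. N (cmatrix i) \<le> 2"
  obtains L where "AE \<gamma> in \<mu>. (\<lambda>n. ln (N (cocycle n \<gamma>)) / real n) \<longlonglongrightarrow> L"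
proof -
  interpret ergodic_system \<mu> stl
    by (rule ergodic_system_stl[OF erg])
  define g where "g n \<gamma> = ln (3 * N (cocycle n \<gamma>))" for n \<gamma>
  have N_pos: "0 < N (cocycle n \<gamma>)" for n \<gamma>
    using lower[of n \<gamma>] by linarith
  have subadd: "g (m + n) \<gamma> \<le> g m \<gamma> + g n (sdrop m \<gamma>)" for m n \<gamma>
  proof -
    have "3 * N (cocycle (m + n) \<gamma>) \<le> (3 * N (cocycle m \<gamma>)) * (3 * N (cocycle n (sdrop m \<gamma>)))"
      using mult[of "cocycle m \<gamma>" "cocycle n (sdrop m \<gamma>)"] by (simp add: cocycle_add)
    then have "g (m + n) \<gamma> \<le> ln ((3 * N (cocycle m \<gamma>)) * (3 * N (cocycle n (sdrop m \<gamma>))))"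
      unfolding g_def using N_pos[of "m + n" \<gamma>] by (subst ln_le_cancel_iff) (auto intro: mult_pos_pos N_pos)
    also have "\<dots> = g m \<gamma> + g n (sdrop m \<gamma>)"
      unfolding g_def by (rule ln_mult_pos) (auto intro: mult_pos_pos N_pos)
    finally show ?thesis .
  qed
  have g_nonneg: "0 \<le> g n \<gamma>" for n \<gamma>
    using lower[of n \<gamma>] by (simp add: g_def)
  have g_1: "g 1 \<gamma> \<le> ln 6" for \<gamma>
    unfolding g_def cocycle_1 using upper[of "shd \<gamma>"] N_pos[of 1 \<gamma>] unfolding cocycle_1 by simp
  have g_le: "g n \<gamma> \<le> ln 6 * real n" if "n > 0" for n \<gamma>
    using that
  proof (induction n arbitrary: \<gamma> rule: nat_induct_non_zero)
    case 1
    then show ?case using g_1 by simp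
  next
    case (Suc n)
    show ?case
      using subadd[of 1 n \<gamma>] g_1[of \<gamma>] Suc(2)[of "sdrop 1 \<gamma>"] by (simp add: algebra_simps)
  qed
  interpret bounded_subadditive \<mu> stl g "ln 6"
  proof
    fix n
    have "g n = (\<lambda>l. ln (3 * N (foldr (\<lambda>i M. cmatrix i ** M) l (mat 1)))) \<circ> stake n"
      by (simp add: fun_eq_iff g_def cocycle_def)
    then show "g n \<in> borel_measurable \<mu>"
      using measurable_comp[OF measurable_stake_shift[OF erg]] by (metis borel_measurable_count_space)
  next
    show "g (m + n) \<gamma> \<le> g m \<gamma> + g n ((stl ^^ m) \<gamma>)" for m n \<gamma>
      using subadd by (simp add: sdrop_eq_funpow)
  next
    show "\<bar>g n \<gamma>\<bar> \<le> ln 6 * real n" if "0 < n" for n \<gamma>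
      using g_nonneg g_le[OF that] by simp
  qed
  obtain L where "AE \<gamma> in \<mu>. (\<lambda>n. g n \<gamma> / real n) \<longlonglongrightarrow> L"
    by (rule subadditive_ergodic_theorem)
  then have "AE \<gamma> in \<mu>. (\<lambda>n. ln (N (cocycle n \<gamma>)) / real n) \<longlonglongrightarrow> L"
  proof eventually_elim
    case (elim \<gamma>)
    have "(\<lambda>n. g n \<gamma> / real n - ln 3 / real n) \<longlonglongrightarrow> L - 0"
      by (intro tendsto_diff elim lim_const_over_n)
    moreover have "g n \<gamma> / real n - ln 3 / real n = ln (N (cocycle n \<gamma>)) / real n" for n
      using N_pos[of n \<gamma>] by (simp add: g_def ln_mult_pos flip: diff_divide_distrib)
    ultimately show ?case by simp
  qed
  then show thesis by (rule that)
qed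

theorem theorem3:
  fixes \<mu> :: "2 stream measure"
  assumes "ergodic_shift_measure \<mu>"
    and "measure \<mu> (cylinder [1, 2, 1, 2, 1, 2, 1, 2]) > 0"
  shows "(AE \<gamma> in \<mu>. \<exists>w. word_tendsto (approx_word \<gamma>) w \<and> balanced w) \<and>
         (\<exists>\<theta>1 \<theta>2 \<theta>3. lyapunov_exponents \<mu> \<theta>1 \<theta>2 \<theta>3 \<and> \<theta>2 < 0)"
proof -
  interpret ergodic_system \<mu> stl
    by (rule ergodic_system_stl[OF assms(1)])
  obtain p where p: "p > 0" and freq: "AE \<gamma> in \<mu>. frequent_blocks p \<gamma>"
    by (rule AE_frequent_blocks[OF assms])
  have upper_1: "ext_norm 1 (cmatrix i) \<le> 2" for i
    using ext_norm_1_cmatrix[of i] by linarith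
  obtain L1 where L1: "AE \<gamma> in \<mu>. (\<lambda>n. ln (ext_norm 1 (cocycle n \<gamma>)) / real n) \<longlonglongrightarrow> L1"
    by (rule growth_exponent_exists[OF assms(1) ext_norm_1_mult ext_norm_1_cocycle_ge upper_1])
  obtain L2 where L2: "AE \<gamma> in \<mu>. (\<lambda>n. ln (ext_norm 2 (cocycle n \<gamma>)) / real n) \<longlonglongrightarrow> L2"
    by (rule growth_exponent_exists[OF assms(1) ext_norm_2_mult ext_norm_2_cocycle_ge ext_norm_2_cmatrix])
  \<comment> \<open>\<open>L1\<close> and \<open>L2\<close> are constants, so inequalities between
    them can be read off at a single sequence.\<close>
  have "AE \<gamma> in \<mu>. frequent_blocks p \<gamma> \<and>
      (\<lambda>n. ln (ext_norm 1 (cocycle n \<gamma>)) / real n) \<longlonglongrightarrow> L1 \<and>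
      (\<lambda>n. ln (ext_norm 2 (cocycle n \<gamma>)) / real n) \<longlonglongrightarrow> L2"
    using freq L1 L2 by eventually_elim simp
  then obtain \<gamma> where \<gamma>: "frequent_blocks p \<gamma>"
    and lim1: "(\<lambda>n. ln (ext_norm 1 (cocycle n \<gamma>)) / real n) \<longlonglongrightarrow> L1"
    and lim2: "(\<lambda>n. ln (ext_norm 2 (cocycle n \<gamma>)) / real n) \<longlonglongrightarrow> L2"
    using eventually_happens[of _ "ae_filter \<mu>"] ae_filter_bot emeasure_space_1 by blast
  define a b where "a n = ext_norm 1 (cocycle n \<gamma>)" and "b n = ext_norm 2 (cocycle n \<gamma>)" for n
  have a: "a n > 0" "1/3 \<le> a n" and b: "b n > 0" for n
    using ext_norm_1_cocycle_ge[of n \<gamma>] ext_norm_2_cocycle_ge[of n \<gamma>] by (simp_all add: a_def b_def)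
  have const: "(\<lambda>n. c / real n) \<longlonglongrightarrow> 0" for c :: real
    by (rule lim_const_over_n)
  \<comment> \<open>Together with \<open>L2 < L1\<close> this orders the first two exponents,
    \<open>L1\<close> and \<open>L2 - L1\<close>.\<close>
  have "0 \<le> L1"
  proof (rule LIMSEQ_le[OF const lim1, of "ln (1/3)"])
    show "\<exists>N. \<forall>n\<ge>N. ln (1/3) / real n \<le> ln (ext_norm 1 (cocycle n \<gamma>)) / real n"
      using a by (auto simp: a_def intro!: divide_right_mono)
  qed
  \<comment> \<open>The second exterior power is smaller than the matrix by a factor of order
    \<open>decay_rate p ^ n\<close>, which makes \<open>L2 - L1\<close> negative.\<close>
  moreover have "L2 \<le> L1 + ln (decay_rate p)"
  proof -
    obtain K where K: "\<And>n. b n \<le> K * decay_rate p ^ n * a n"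
      unfolding a_def b_def using ext_norm_2_cocycle_le[OF \<gamma> p] by blast
    have r: "decay_rate p > 0"
      by (rule decay_rate_bounds)
    have "0 < K * a 0"
      using K[of 0] b[of 0] by simp
    then have K_pos: "K > 0"
      using a(1)[of 0] by (simp add: zero_less_mult_iff)
    have "ln (b n) / real n \<le> ln K / real n + ln (decay_rate p) + ln (a n) / real n" if "n \<ge> 1" for n
    proof -
      have "ln (b n) \<le> ln (K * decay_rate p ^ n * a n)"
        using K[of n] b[of n] by (intro ln_mono) auto
      also have "\<dots> = ln K + real n * ln (decay_rate p) + ln (a n)"
        using K_pos r a(1)[of n] by (simp add: ln_mult_pos ln_realpow)
      finally show ?thesis
        using that by (simp add: field_simps)
    qed
    moreover have "(\<lambda>n. ln K / real n + ln (decay_rate p) + ln (a n) / real n) \<longlonglongrightarrow> 0 + ln (decay_rate p) + L1"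
      unfolding a_def by (intro tendsto_intros const lim1)
    ultimately have "L2 \<le> 0 + ln (decay_rate p) + L1"
      using lim2 unfolding b_def by (intro LIMSEQ_le) blast+
    then show ?thesis by simp
  qed
  moreover have "ln (decay_rate p) < 0"
    using decay_rate_bounds[of p] p by simp
  \<comment> \<open>The ordering \<open>- L2 \<le> L2 - L1\<close> of the last two
    exponents.\<close>
  moreover have "L1 \<le> 2 * L2"
  proof -
    have "ln (a n) / real n \<le> ln 2 / real n + 2 * (ln (b n) / real n)" for n
    proof -
      have "a n \<le> 2 * (b n)\<^sup>2"
        unfolding a_def b_def by (rule ext_norm_1_le_ext_norm_2[OF det_cocycle])
      then have "ln (a n) \<le> ln (2 * (b n)\<^sup>2)"
        using a(1)[of n] by (intro ln_mono) auto
      also have "\<dots> = ln 2 + 2 * ln (b n)"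
        using b[of n] by (simp add: ln_mult_pos ln_realpow)
      finally show ?thesis
        by (simp add: divide_right_mono flip: add_divide_distrib)
    qed
    moreover have "(\<lambda>n. ln 2 / real n + 2 * (ln (b n) / real n)) \<longlonglongrightarrow> 0 + 2 * L2"
      unfolding b_def by (intro tendsto_intros const lim2)
    ultimately have "L1 \<le> 0 + 2 * L2"
      using lim1 unfolding a_def by (intro LIMSEQ_le) blast+
    then show ?thesis by simp
  qed
  \<comment> \<open>The determinant has absolute value 1, so the exponents sum to zero and the third
    is \<open>- L2\<close>.\<close>
  moreover have "AE \<gamma> in \<mu>. (\<lambda>n. ln (ext_norm 3 (cocycle n \<gamma>)) / real n) \<longlonglongrightarrow> 0"
    by (simp add: ext_norm_3 det_cocycle)
  ultimately have "lyapunov_exponents \<mu> L1 (L2 - L1) (- L2)" "L2 - L1 < 0"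
    using L1 L2 by (simp_all add: lyapunov_exponents_def)
  moreover have "AE \<gamma> in \<mu>. \<exists>w. word_tendsto (approx_word \<gamma>) w \<and> balanced w"
    using freq by eventually_elim (rule limit_word_balanced[OF _ p])
  ultimately show ?thesis by blast
qed

end
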